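(* Let $\mathbf{s}=(s_n)_{n=1}^\infty$ be an increasing weight whose discrete derivative is essentially decreasing. Then the unit vector system of the Marcinkiewicz space $m(\mathbf{s})$ satisfies Lechner's condition if and only if \[ \inf_{n\in\mathbb{N}}\ \sup_{k\in\mathbb{N}} \frac{s_k}{s_{kn}}=0 . \]
   Context: $\mathbb{F}$ is the real or complex field. A weight is a sequence of positive scalars. The discrete derivative of $\mathbf{s}=(s_n)_{n=1}^\infty$ is the weight $\mathbf{w}=(w_j)_{j=1}^\infty$ with $s_n=\sum_{j=1}^n w_j$ for all $n\in\mathbb{N}$. A weight $(w_n)_{n=1}^\infty$ is essentially decreasing if $\inf_{m\le n} w_m/w_n>0$. The Marcinkiewicz space $m(\mathbf{s})$ is the Banach space of all $f=(a_j)_{j=1}^\infty\in\mathbb{F}^{\mathbb{N}}$ such that $\|f\|_{m(\mathbf{s})}:=\sup\{ \frac{1}{s_n}\sum_{j\in A}|a_j| : n\in\mathbb{N},\ A\subseteq\mathbb{N},\ |A|=n\}<\infty$. The unit vector system is $(\mathbf{e}_k)_{k=1}^\infty$, $\mathbf{e}_k=(\delta_{k,n})_{n=1}^\infty$; it is an unconditional basic sequence in $m(\mathbf{s})$. Lechner's condition. Let $(\mathbf{x}_j)_{j=1}^\infty$ be an unconditional basis of a Banach space $\mathbb{X}$, with sequence of coordinate functionals (dual basic sequence) $(\mathbf{x}_j^* )_{j=1}^\infty$. For $A\subseteq\mathbb{N}$ let $P_A(f)=\sum_{j\in A}\mathbf{x}_j^*(f)\,\mathbf{x}_j$ be the coordinate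 projection on $\mathbb{X}$, and $P_A^*$ its adjoint on $\mathbb{X}^*$. The sequence $(\mathbf{x}_j^* )_{j=1}^\infty$ verifies Lechner's condition if for every infinite $A\subseteq\mathbb{N}$ and every $\theta>0$ there is a sequence $(A_n)_{n=1}^\infty$ of pairwise disjoint infinite subsets of $A$ such that for every sequence $(f_n^* )_{n=1}^\infty$ in the closed unit ball of $\mathbb{X}^*$ there is $(a_n)_{n=1}^\infty$ in the unit sphere of $\ell_1$ with $\|\sum_{n=1}^\infty a_n P_{A_n}^*(f_n^* )\|\le\theta$. An arbitrary unconditional basic sequence $\mathcal{B}$ (a basis of its closed linear span $\mathbb{Y}$) is said to satisfy Lechner's condition by regarding it as a dual basic sequence: let $\mathbb{X}$ be the closed linear span in $\mathbb{Y}^*$ of the coordinate functionals $\mathcal{B}^*$ of $\mathcal{B}$; then $\mathcal{B}^*$ is an unconditional basis of $\mathbb{X}$ and, via the natural isomorphic embedding of $\mathbb{Y}$ into $\mathbb{X}^*$, $\mathcal{B}$ is the dual basic sequence of $\mathcal{B}^*$; the condition is then the one above for the basis $\mathcal{B}^*$ of $\mathbb{X}$. *)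

theory Defs
  imports Complex_Main "HOL-Library.Function_Algebras" "HOL-Library.Disjoint_Sets"
begin

(* Normed spaces over a scalar field 'f (real or complex below). The library's type classes only
   provide real-linear structure on whole types, whereas here linearity is over 'f and the
   spaces are spans, closures and duals, so the carrier, the scalar multiplication and the norm are
   explicit. Addition is that of the type; 'smul' is meant to make the whole type a vector space,
   and 'nrm' is only meaningful on 'vecs'. *)

record ('f, 'v) nspace =
  vecs :: "'v set"
  smul :: "'f \<Rightarrow> 'v \<Rightarrow> 'v"
  nrm :: "'v \<Rightarrow> real"

(* Unconditional (unordered) norm convergence of the sum of h over A to g; the analogue of the
   library's has_sum. *)
definition has_nsum ::
    "('f, 'v::ab_group_add) nspace \<Rightarrow> ('i \<Rightarrow> 'v) \<Rightarrow> 'i set \<Rightarrow> 'v \<Rightarrow> bool" where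
  "has_nsum V h A g \<longleftrightarrow>
     g \<in> vecs V \<and> ((\<lambda>F. nrm V (sum h F - g)) \<longlongrightarrow> 0) (finite_subsets_at_top A)"

definition closed_span ::
    "('f::real_normed_field, 'v::ab_group_add) nspace \<Rightarrow> 'v set \<Rightarrow> ('f, 'v) nspace" where
  "closed_span V S =
     V\<lparr>vecs := {f \<in> vecs V. \<forall>\<epsilon>>0. \<exists>g \<in> module.span (smul V) S. nrm V (f - g) < \<epsilon>}\<rparr>"

(* Bounded 'f-linear functionals on the carrier. They are set to 0 outside the carrier, so that
   functionals on V correspond one-to-one to elements of the dual. *)
definition dual ::
    "('f::real_normed_field, 'v::ab_group_add) nspace \<Rightarrow> ('f, 'v \<Rightarrow> 'f) nspace" where
  "dual V =
     \<lparr>vecs = {\<phi>. (\<forall>x\<in>vecs V. \<forall>y\<in>vecs V. \<phi> (x + y) = \<phi> x + \<phi> y) \<and>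
                 (\<forall>c. \<forall>x\<in>vecs V. \<phi> (smul V c x) = c * \<phi> x) \<and>
                 (\<exists>C. \<forall>x\<in>vecs V. norm (\<phi> x) \<le> C * nrm V x) \<and>
                 (\<forall>x. x \<notin> vecs V \<longrightarrow> \<phi> x = 0)},
      smul = (\<lambda>c \<phi> x. c * \<phi> x),
      nrm = (\<lambda>\<phi>. SUP x\<in>{x \<in> vecs V. nrm V x \<le> 1}. norm (\<phi> x))\<rparr>"

definition adjoint ::
    "('f, 'v) nspace \<Rightarrow> ('v \<Rightarrow> 'v) \<Rightarrow> ('v \<Rightarrow> 'f::zero) \<Rightarrow> 'v \<Rightarrow> 'f" where
  "adjoint V T \<phi> x = (if x \<in> vecs V then \<phi> (T x) else 0)"

(* In coord, coord_proj and lechner_dual, x is meant to be an unconditional basis of the Banach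
   space V, i.e. every f in V has exactly one expansion as an unconditionally convergent series
   of multiples of the x j. The descriptions below are then well-defined. *)

definition coord ::
    "('f, 'v::ab_group_add) nspace \<Rightarrow> (nat \<Rightarrow> 'v) \<Rightarrow> nat \<Rightarrow> 'v \<Rightarrow> 'f::zero" where
  "coord V x j f =
     (if f \<in> vecs V then (THE a. has_nsum V (\<lambda>i. smul V (a i) (x i)) UNIV f) j else 0)"

definition coord_proj ::
    "('f::zero, 'v::ab_group_add) nspace \<Rightarrow> (nat \<Rightarrow> 'v) \<Rightarrow> nat set \<Rightarrow> 'v \<Rightarrow> 'v" where
  "coord_proj V x A f = (THE g. has_nsum V (\<lambda>j. smul V (coord V x j f) (x j)) A g)"

(* Lechner's condition for the coordinate functionals of the basis x of V. *)
definition lechner_dual ::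
    "('f::real_normed_field, 'v::ab_group_add) nspace \<Rightarrow> (nat \<Rightarrow> 'v) \<Rightarrow> bool" where
  "lechner_dual V x \<longleftrightarrow>
     (\<forall>A. infinite A \<longrightarrow> (\<forall>\<theta>>0.
       \<exists>B :: nat \<Rightarrow> nat set. disjoint_family B \<and> (\<forall>n. infinite (B n) \<and> B n \<subseteq> A) \<and>
         (\<forall>\<phi>. (\<forall>n. \<phi> n \<in> vecs (dual V) \<and> nrm (dual V) (\<phi> n) \<le> 1) \<longrightarrow>
           (\<exists>a g. (\<lambda>n. norm (a n)) sums 1 \<and>
              has_nsum (dual V)
                (\<lambda>n. smul (dual V) (a n) (adjoint V (coord_proj V x (B n)) (\<phi> n))) UNIV g \<and>
              nrm (dual V) g \<le> \<theta>))))"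

(* Lechner's condition for an unconditional basic sequence b in V: with Y the closed span of b,
   the condition for the coordinate functionals b* of b, as a basis of their closed span in the
   dual of Y. *)
definition lechner ::
    "('f::real_normed_field, 'v::ab_group_add) nspace \<Rightarrow> (nat \<Rightarrow> 'v) \<Rightarrow> bool" where
  "lechner V b \<longleftrightarrow>
     (let Y = closed_span V (range b);
          b' = coord Y b
      in lechner_dual (closed_span (dual Y) (range b')) b')"

(* Weights are indexed by the positive integers: their value at 0 is irrelevant. *)

definition weight :: "(nat \<Rightarrow> real) \<Rightarrow> bool" where
  "weight s \<longleftrightarrow> (\<forall>n\<ge>1. s n > 0)"

definition discrete_derivative :: "(nat \<Rightarrow> real) \<Rightarrow> (nat \<Rightarrow> real) \<Rightarrow> bool" where
  "discrete_derivative s w \<longleftrightarrow> weight w \<and> (\<forall>n\<ge>1. s n = (\<Sum>j=1..n. w j))"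

definition essentially_decreasing :: "(nat \<Rightarrow> real) \<Rightarrow> bool" where
  "essentially_decreasing w \<longleftrightarrow> Inf {w m / w n | m n. 1 \<le> m \<and> m \<le> n} > 0"

(* The entries of the sequences f are indexed from 0; this is immaterial, since only the
   cardinality of the sets A matters. *)

definition marcinkiewicz_averages ::
    "(nat \<Rightarrow> real) \<Rightarrow> (nat \<Rightarrow> 'f::real_normed_field) \<Rightarrow> real set" where
  "marcinkiewicz_averages s f =
     {1 / s n * (\<Sum>j\<in>A. norm (f j)) | n A. n \<ge> 1 \<and> finite A \<and> card A = n}"

definition marcinkiewicz ::
    "(nat \<Rightarrow> real) \<Rightarrow> ('f::real_normed_field, nat \<Rightarrow> 'f) nspace" where
  "marcinkiewicz s =
     \<lparr>vecs = {f. bdd_above (marcinkiewicz_averages s f)},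
      smul = (\<lambda>c f j. c * f j),
      nrm = (\<lambda>f. Sup (marcinkiewicz_averages s f))\<rparr>"

definition unit_vector :: "nat \<Rightarrow> nat \<Rightarrow> 'f::zero_neq_one" where
  "unit_vector k n = (if n = k then 1 else 0)"

end

theory Submission
  imports Defs "HOL-Library.Infinite_Set" "HOL-Library.Nat_Bijection"
begin

text \<open>
  Let \<open>Y\<close> be the closed span of the unit vectors in \<open>m(s)\<close> and \<open>X\<close> the closed span in \<open>Y*\<close> of their
  coordinate functionals. Then \<open>X*\<close> is isometric to \<open>m(s)\<close>: testing on sign combinations of coordinate
  functionals bounds the sums defining the norm of \<open>m(s)\<close>, and testing on finitely supported vectors
  of \<open>Y\<close> bounds the norm of \<open>X*\<close>. So Lechner's condition concerns disjoint blocks in \<open>m(s)\<close>.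

  If the infimum is positive, copy the sequence \<open>w\<close> along each \<open>A\<^sub>n\<close>. These vectors are bounded in \<open>m(s)\<close>
  because \<open>w\<close> is essentially decreasing. Summing \<open>\<bar>\<Sum> a\<^sub>n f\<^sub>n\<bar>\<close> over the first \<open>k\<close> elements of each of
  \<open>A\<^sub>1, \<dots>, A\<^sub>N\<close> gives \<open>s\<^sub>k \<Sum> \<bar>a\<^sub>n\<bar>\<close> on a set of size \<open>kN\<close>, and choosing \<open>k\<close> with \<open>s\<^sub>k\<close> comparable to \<open>s\<^sub>k\<^sub>N\<close>
  shows that they span \<open>l\<^sub>1\<close>. If the infimum is zero, averages over \<open>N\<close> blocks are small: by quasiconcavity
  \<open>(1/N) \<Sum> s(k\<^sub>i)\<close> with \<open>\<Sum> k\<^sub>i = k\<close> is at most a constant times \<open>s(k/N)\<close>, hence small relative to \<open>s(k)\<close>.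
\<close>

section \<open>Normed spaces, duals and closed spans\<close>

text \<open>Homogeneity is demanded only as an inequality; using it for a scalar and its inverse
  gives equality, and nonnegativity then follows from the triangle inequality. This keeps the
  obligations short for the instances: closed spans, duals and the Marcinkiewicz space
  itself.\<close>

locale nspace_normed =
  fixes V :: "('f::real_normed_field, 'v::ab_group_add) nspace"
  assumes module_smul: "module (smul V)"
    and zero_mem: "0 \<in> vecs V"
    and add_mem: "f \<in> vecs V \<Longrightarrow> g \<in> vecs V \<Longrightarrow> f + g \<in> vecs V"
    and smul_mem: "f \<in> vecs V \<Longrightarrow> smul V c f \<in> vecs V"
    and nrm_add_le: "f \<in> vecs V \<Longrightarrow> g \<in> vecs V \<Longrightarrow> nrm V (f + g) \<le> nrm V f + nrm V g"
    and nrm_smul_le: "f \<in> vecs V \<Longrightarrow> nrm V (smul V c f) \<le> norm c * nrm V f"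
    and nrm_eq_0D: "f \<in> vecs V \<Longrightarrow> nrm V f = 0 \<Longrightarrow> f = 0"
begin

sublocale module "smul V"
  by (rule module_smul)

lemma uminus_mem: "f \<in> vecs V \<Longrightarrow> - f \<in> vecs V"
  using smul_mem[of f "-1"] by simp

lemma diff_mem: "f \<in> vecs V \<Longrightarrow> g \<in> vecs V \<Longrightarrow> f - g \<in> vecs V"
  using add_mem[of f "- g"] uminus_mem[of g] by simp

lemma sum_mem: "(\<And>i. i \<in> I \<Longrightarrow> h i \<in> vecs V) \<Longrightarrow> sum h I \<in> vecs V"
  by (induction I rule: infinite_finite_induct) (auto intro: zero_mem add_mem)

lemma nrm_zero: "nrm V 0 = 0"
  using nrm_smul_le[OF zero_mem, of 0] nrm_add_le[OF zero_mem zero_mem] by simp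

lemma nrm_smul:
  assumes "f \<in> vecs V"
  shows "nrm V (smul V c f) = norm c * nrm V f"
proof (cases "c = 0")
  case False
  then have "nrm V f \<le> norm (inverse c) * nrm V (smul V c f)"
    using nrm_smul_le[OF smul_mem[OF assms], of "inverse c" c] by simp
  then show ?thesis
    using nrm_smul_le[OF assms, of c] False by (auto simp: norm_inverse field_simps norm_divide intro: antisym)
qed (simp add: nrm_zero)

lemma nrm_minus: "f \<in> vecs V \<Longrightarrow> nrm V (- f) = nrm V f"
  using nrm_smul[of f "-1"] by simp

lemma nrm_nonneg: "f \<in> vecs V \<Longrightarrow> 0 \<le> nrm V f"
  using nrm_add_le[of f "- f"] nrm_minus[of f] uminus_mem[of f] nrm_zero by simp

lemma nrm_diff_le: "f \<in> vecs V \<Longrightarrow> g \<in> vecs V \<Longrightarrow> nrm V (f - g) \<le> nrm V f + nrm V g"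
  using nrm_add_le[of f "- g"] nrm_minus[of g] uminus_mem[of g] by simp

lemma span_subset_vecs: "S \<subseteq> vecs V \<Longrightarrow> span S \<subseteq> vecs V"
  by (rule span_minimal) (auto simp: subspace_def zero_mem add_mem smul_mem)

lemma has_nsum_unique:
  assumes "\<And>i. i \<in> A \<Longrightarrow> h i \<in> vecs V" "has_nsum V h A g" "has_nsum V h A g'"
  shows "g = g'"
proof -
  have g: "g \<in> vecs V" "g' \<in> vecs V"
    using assms(2,3) by (auto simp: has_nsum_def)
  have lim: "((\<lambda>F. nrm V (sum h F - g) + nrm V (sum h F - g')) \<longlongrightarrow> 0 + 0) (finite_subsets_at_top A)"
    using assms(2,3) unfolding has_nsum_def by (intro tendsto_add) auto
  have "eventually (\<lambda>F. nrm V (g' - g) \<le> nrm V (sum h F - g) + nrm V (sum h F - g'))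
     (finite_subsets_at_top A)"
  proof (rule eventually_finite_subsets_at_top_weakI)
    fix F assume "finite F" "F \<subseteq> A"
    then have "sum h F \<in> vecs V"
      by (intro sum_mem assms(1)) auto
    then show "nrm V (g' - g) \<le> nrm V (sum h F - g) + nrm V (sum h F - g')"
      using nrm_diff_le[of "sum h F - g" "sum h F - g'"] g by (simp add: diff_mem)
  qed
  then have "nrm V (g' - g) \<le> 0"
    using tendsto_lowerbound[OF lim] by simp
  then have "nrm V (g' - g) = 0"
    using nrm_nonneg[of "g' - g"] g by (simp add: diff_mem)
  then show ?thesis
    using nrm_eq_0D[of "g' - g"] g by (simp add: diff_mem)
qed

lemma has_nsum_finite:
  assumes "finite F" "F \<subseteq> A" "\<And>i. i \<in> F \<Longrightarrow> h i \<in> vecs V" "\<And>i. i \<in> A - F \<Longrightarrow> h i = 0"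
  shows "has_nsum V h A (sum h F)"
proof -
  have "eventually (\<lambda>G. nrm V (sum h G - sum h F) = 0) (finite_subsets_at_top A)"
    unfolding eventually_finite_subsets_at_top
  proof (intro exI conjI allI impI)
    fix G assume "finite G \<and> F \<subseteq> G \<and> G \<subseteq> A"
    then have "sum h G = sum h F"
      using assms(4) by (intro sum.mono_neutral_right) auto
    then show "nrm V (sum h G - sum h F) = 0"
      by (simp add: nrm_zero)
  qed (use assms in auto)
  then show ?thesis
    using assms(3) by (auto simp: has_nsum_def intro: sum_mem tendsto_eventually)
qed

section \<open>Bounded functionals and the dual norm\<close>

lemma
  assumes "\<phi> \<in> vecs (dual V)"
  shows dual_add: "f \<in> vecs V \<Longrightarrow> g \<in> vecs V \<Longrightarrow> \<phi> (f + g) = \<phi> f + \<phi> g"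
    and dual_smul: "f \<in> vecs V \<Longrightarrow> \<phi> (smul V c f) = c * \<phi> f"
    and dual_outside: "f \<notin> vecs V \<Longrightarrow> \<phi> f = 0"
  using assms by (auto simp: dual_def)

lemma dual_zero: "\<phi> \<in> vecs (dual V) \<Longrightarrow> \<phi> 0 = 0"
  using dual_smul[of \<phi> 0 0] zero_mem by simp

lemma dual_diff:
  "\<phi> \<in> vecs (dual V) \<Longrightarrow> f \<in> vecs V \<Longrightarrow> g \<in> vecs V \<Longrightarrow> \<phi> (f - g) = \<phi> f - \<phi> g"
  using dual_add[of \<phi> "f - g" g] diff_mem[of f g] by simp

lemma dual_sum:
  "\<phi> \<in> vecs (dual V) \<Longrightarrow> (\<And>i. i \<in> I \<Longrightarrow> h i \<in> vecs V) \<Longrightarrow> \<phi> (sum h I) = (\<Sum>i\<in>I. \<phi> (h i))"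
  by (induction I rule: infinite_finite_induct) (auto simp: dual_zero dual_add sum_mem)

lemma dual_apply_le:
  assumes "\<phi> \<in> vecs (dual V)" "f \<in> vecs V"
  shows "norm (\<phi> f) \<le> nrm (dual V) \<phi> * nrm V f"
proof (cases "nrm V f = 0")
  case True
  then show ?thesis
    using nrm_eq_0D[OF assms(2)] dual_zero[OF assms(1)] by simp
next
  case False
  then have pos: "nrm V f > 0"
    using nrm_nonneg[OF assms(2)] by simp
  obtain C where C: "\<And>x. x \<in> vecs V \<Longrightarrow> norm (\<phi> x) \<le> C * nrm V x"
    using assms(1) unfolding dual_def by force
  let ?c = "of_real (inverse (nrm V f)) :: 'f"
  have bdd: "bdd_above ((\<lambda>x. norm (\<phi> x)) ` {x \<in> vecs V. nrm V x \<le> 1})"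
  proof (rule bdd_aboveI2)
    fix x assume "x \<in> {x \<in> vecs V. nrm V x \<le> 1}"
    then have x: "x \<in> vecs V" "nrm V x \<le> 1" by auto
    \<comment> \<open>The constant supplied by \<open>dual\<close> carries no sign condition, so its
      absolute value serves as the uniform bound on the unit ball.\<close>
    have "C * nrm V x \<le> \<bar>C\<bar> * nrm V x"
      using nrm_nonneg[OF x(1)] by (intro mult_right_mono) auto
    also have "\<dots> \<le> \<bar>C\<bar>"
      using x(2) by (simp add: mult_left_le)
    finally show "norm (\<phi> x) \<le> \<bar>C\<bar>"
      using C[OF x(1)] by linarith
  qed
  have "norm (\<phi> (smul V ?c f)) \<le> nrm (dual V) \<phi>"
    unfolding dual_def nspace.simps
    by (rule cSUP_upper[OF _ bdd]) (use pos assms in \<open>auto simp: nrm_smul smul_mem norm_inverse\<close>)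
  then show ?thesis
    using pos assms by (simp add: dual_smul norm_mult norm_divide field_simps)
qed

lemma nrm_dual_le:
  assumes "0 \<le> C" "\<And>f. f \<in> vecs V \<Longrightarrow> norm (\<phi> f) \<le> C * nrm V f"
  shows "nrm (dual V) \<phi> \<le> C"
  unfolding dual_def nspace.simps
proof (rule cSUP_least)
  show "{x \<in> vecs V. nrm V x \<le> 1} \<noteq> {}"
    using zero_mem nrm_zero by force
  fix f assume "f \<in> {x \<in> vecs V. nrm V x \<le> 1}"
  then show "norm (\<phi> f) \<le> C"
    using assms(2)[of f] mult_left_le[of "nrm V f" C] assms(1) by force
qed

text \<open>A negative value would force \<phi> = 0 through \<open>dual_apply_le\<close>, but for
  \<phi> = 0 the supremum runs over {0}.\<close>

lemma nrm_dual_nonneg: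
  assumes "\<phi> \<in> vecs (dual V)"
  shows "0 \<le> nrm (dual V) \<phi>"
proof -
  have "\<phi> f = 0" if "nrm (dual V) \<phi> < 0" for f
  proof (cases "f \<in> vecs V")
    case True
    then have "nrm (dual V) \<phi> * nrm V f \<le> 0"
      using that nrm_nonneg by (simp add: mult_le_0_iff)
    then show ?thesis
      using dual_apply_le[OF assms True] norm_ge_zero[of "\<phi> f"] by (metis norm_le_zero_iff order_trans)
  qed (simp add: dual_outside[OF assms])
  moreover have "nrm (dual V) \<phi> = 0" if "\<And>f. \<phi> f = 0"
  proof -
    have "0 \<in> {x \<in> vecs V. nrm V x \<le> 1}"
      by (simp add: zero_mem nrm_zero)
    then have "(\<lambda>x. norm (\<phi> x)) ` {x \<in> vecs V. nrm V x \<le> 1} = {0}"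
      using that by auto
    then show ?thesis
      by (simp add: dual_def)
  qed
  ultimately show ?thesis
    by force
qed

lemma dual_memI:
  assumes "\<And>f g. f \<in> vecs V \<Longrightarrow> g \<in> vecs V \<Longrightarrow> \<phi> (f + g) = \<phi> f + \<phi> g"
    and "\<And>c f. f \<in> vecs V \<Longrightarrow> \<phi> (smul V c f) = c * \<phi> f"
    and "\<And>f. f \<in> vecs V \<Longrightarrow> norm (\<phi> f) \<le> C * nrm V f"
    and "\<And>f. f \<notin> vecs V \<Longrightarrow> \<phi> f = 0"
  shows "\<phi> \<in> vecs (dual V)"
  unfolding dual_def using assms by simp (blast intro: assms(3))

lemma smul_dual: "smul (dual V) = (\<lambda>c \<phi> x. c * \<phi> x)"
  by (simp add: dual_def)

lemma dual_normed: "nspace_normed (dual V)"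
proof
  show "\<And>c (f::'v \<Rightarrow> 'f) g. smul (dual V) c (f + g) = smul (dual V) c f + smul (dual V) c g"
    "\<And>c d (f::'v \<Rightarrow> 'f). smul (dual V) (c + d) f = smul (dual V) c f + smul (dual V) d f"
    "\<And>c d (f::'v \<Rightarrow> 'f). smul (dual V) c (smul (dual V) d f) = smul (dual V) (c * d) f"
    "\<And>f::'v \<Rightarrow> 'f. smul (dual V) 1 f = f"
    by (auto simp: smul_dual algebra_simps fun_eq_iff)
  show "0 \<in> vecs (dual V)"
    by (rule dual_memI[where C = 0]) auto
next
  fix \<phi> \<psi> assume \<phi>\<psi>: "\<phi> \<in> vecs (dual V)" "\<psi> \<in> vecs (dual V)"
  have le: "norm ((\<phi> + \<psi>) f) \<le> (nrm (dual V) \<phi> + nrm (dual V) \<psi>) * nrm V f"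
    if "f \<in> vecs V" for f
    using dual_apply_le[OF \<phi>\<psi>(1) that] dual_apply_le[OF \<phi>\<psi>(2) that]
      norm_triangle_ineq[of "\<phi> f" "\<psi> f"] by (simp add: distrib_right)
  show "\<phi> + \<psi> \<in> vecs (dual V)"
    by (rule dual_memI[OF _ _ le])
       (use \<phi>\<psi> in \<open>auto simp: dual_add dual_smul dual_outside distrib_left\<close>)
  show "nrm (dual V) (\<phi> + \<psi>) \<le> nrm (dual V) \<phi> + nrm (dual V) \<psi>"
    by (rule nrm_dual_le[OF _ le]) (use \<phi>\<psi> in \<open>auto simp: nrm_dual_nonneg\<close>)
next
  fix \<phi> and c :: 'f assume \<phi>: "\<phi> \<in> vecs (dual V)"
  have le: "norm (smul (dual V) c \<phi> f) \<le> (norm c * nrm (dual V) \<phi>) * nrm V f"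
    if "f \<in> vecs V" for f
    using dual_apply_le[OF \<phi> that] by (simp add: smul_dual norm_mult mult.assoc mult_left_mono)
  show "smul (dual V) c \<phi> \<in> vecs (dual V)"
    by (rule dual_memI[OF _ _ le])
       (use \<phi> in \<open>auto simp: smul_dual dual_add dual_smul dual_outside algebra_simps\<close>)
  show "nrm (dual V) (smul (dual V) c \<phi>) \<le> norm c * nrm (dual V) \<phi>"
    by (rule nrm_dual_le[OF _ le]) (use \<phi> in \<open>auto simp: nrm_dual_nonneg\<close>)
next
  fix \<phi> assume \<phi>: "\<phi> \<in> vecs (dual V)" "nrm (dual V) \<phi> = 0"
  show "\<phi> = 0"
  proof
    fix f show "\<phi> f = 0 f"
      using dual_apply_le[OF \<phi>(1), of f] dual_outside[OF \<phi>(1), of f] \<phi>(2) by (cases "f \<in> vecs V") auto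
  qed
qed

text \<open>Bounded functionals pass through unordered sums. This is how coefficients are later read
  off from expansions.\<close>

lemma dual_tendsto:
  assumes "\<phi> \<in> vecs (dual V)" "\<And>i. i \<in> A \<Longrightarrow> h i \<in> vecs V" "has_nsum V h A g"
  shows "((\<lambda>F. \<Sum>i\<in>F. \<phi> (h i)) \<longlongrightarrow> \<phi> g) (finite_subsets_at_top A)"
proof (rule LIM_zero_cancel, rule tendsto_0_le)
  show "((\<lambda>F. nrm V (sum h F - g)) \<longlongrightarrow> 0) (finite_subsets_at_top A)"
    using assms(3) unfolding has_nsum_def by auto
  show "eventually (\<lambda>F. norm ((\<Sum>i\<in>F. \<phi> (h i)) - \<phi> g) \<le> norm (nrm V (sum h F - g)) * nrm (dual V) \<phi>)
     (finite_subsets_at_top A)"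
  proof (rule eventually_finite_subsets_at_top_weakI)
    fix F assume "finite F" "F \<subseteq> A"
    then have h: "\<And>i. i \<in> F \<Longrightarrow> h i \<in> vecs V"
      by (auto intro: assms(2))
    have g: "g \<in> vecs V"
      using assms(3) by (simp add: has_nsum_def)
    have "(\<Sum>i\<in>F. \<phi> (h i)) - \<phi> g = \<phi> (sum h F - g)"
      using h g assms(1) by (simp add: dual_diff dual_sum sum_mem)
    then show "norm ((\<Sum>i\<in>F. \<phi> (h i)) - \<phi> g) \<le> norm (nrm V (sum h F - g)) * nrm (dual V) \<phi>"
      using dual_apply_le[OF assms(1), of "sum h F - g"] h g
      by (simp add: diff_mem sum_mem nrm_nonneg mult.commute)
  qed
qed

section \<open>Closed spans as normed spaces\<close>

lemma closed_span_simps: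
  "smul (closed_span V S) = smul V" "nrm (closed_span V S) = nrm V"
  by (simp_all add: closed_span_def)

lemma closed_span_mem_iff:
  "f \<in> vecs (closed_span V S) \<longleftrightarrow> f \<in> vecs V \<and> (\<forall>\<epsilon>>0. \<exists>g\<in>span S. nrm V (f - g) < \<epsilon>)"
  by (simp add: closed_span_def)

lemma closed_span_subset: "vecs (closed_span V S) \<subseteq> vecs V"
  by (auto simp: closed_span_mem_iff)

lemma span_subset_closed_span:
  assumes "S \<subseteq> vecs V"
  shows "span S \<subseteq> vecs (closed_span V S)"
proof
  fix f assume f: "f \<in> span S"
  then show "f \<in> vecs (closed_span V S)"
    using span_subset_vecs[OF assms] by (auto simp: closed_span_mem_iff nrm_zero intro!: bexI[OF _ f])
qed

lemma closed_span_normed: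
  assumes S: "S \<subseteq> vecs V"
  shows "nspace_normed (closed_span V S)"
proof (rule nspace_normed.intro, unfold closed_span_simps)
  show "module (smul V)"
    by (rule module_smul)
  show "0 \<in> vecs (closed_span V S)"
    using span_subset_closed_span[OF S] span_zero by blast
next
  fix f g assume fg: "f \<in> vecs (closed_span V S)" "g \<in> vecs (closed_span V S)"
  then have fg': "f \<in> vecs V" "g \<in> vecs V"
    by (auto simp: closed_span_mem_iff)
  show "f + g \<in> vecs (closed_span V S)"
    unfolding closed_span_mem_iff
  proof (intro conjI allI impI)
    fix \<epsilon> :: real assume "\<epsilon> > 0"
    then have "\<epsilon> / 2 > 0" by simp
    then obtain f' g' where *: "f' \<in> span S" "nrm V (f - f') < \<epsilon> / 2" "g' \<in> span S"
      "nrm V (g - g') < \<epsilon> / 2"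
      using fg unfolding closed_span_mem_iff by metis
    have "f' \<in> vecs V" "g' \<in> vecs V"
      using span_subset_vecs[OF S] * by auto
    then have "nrm V ((f - f') + (g - g')) \<le> nrm V (f - f') + nrm V (g - g')"
      using fg' by (intro nrm_add_le diff_mem)
    then have "nrm V (f + g - (f' + g')) < \<epsilon>"
      using * by (simp add: algebra_simps)
    then show "\<exists>h\<in>span S. nrm V (f + g - h) < \<epsilon>"
      using * span_add by blast
  qed (use fg' in \<open>auto intro: add_mem\<close>)
  show "nrm V (f + g) \<le> nrm V f + nrm V g"
    by (rule nrm_add_le[OF fg'])
next
  fix f c assume f: "f \<in> vecs (closed_span V S)"
  then have f': "f \<in> vecs V"
    by (auto simp: closed_span_mem_iff)
  show "nrm V (smul V c f) \<le> norm c * nrm V f"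
    by (rule nrm_smul_le[OF f'])
  show "smul V c f \<in> vecs (closed_span V S)"
    unfolding closed_span_mem_iff
  proof (intro conjI allI impI)
    fix \<epsilon> :: real assume "\<epsilon> > 0"
    \<comment> \<open>Adding 1 keeps the denominator positive when \<open>c = 0\<close>.\<close>
    then have "\<epsilon> / (norm c + 1) > 0"
      by (intro divide_pos_pos) (auto simp: add_nonneg_pos)
    then obtain f1 where f1: "f1 \<in> span S" "nrm V (f - f1) < \<epsilon> / (norm c + 1)"
      using f unfolding closed_span_mem_iff by metis
    have d: "f - f1 \<in> vecs V"
      using span_subset_vecs[OF S] f1 f' by (auto intro: diff_mem)
    have pos: "norm c + 1 > 0"
      by (simp add: add_nonneg_pos)
    have "norm c * nrm V (f - f1) \<le> (norm c + 1) * nrm V (f - f1)"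
      using nrm_nonneg[OF d] by (intro mult_right_mono) auto
    also have "\<dots> < \<epsilon>"
      using f1(2) pos by (simp add: field_simps)
    finally have "nrm V (smul V c f - smul V c f1) < \<epsilon>"
      using nrm_smul[OF d, of c] by (simp add: scale_right_diff_distrib)
    then show "\<exists>h\<in>span S. nrm V (smul V c f - h) < \<epsilon>"
      using f1 span_scale by blast
  qed (use f' in \<open>auto intro: smul_mem\<close>)
next
  show "\<And>f. f \<in> vecs (closed_span V S) \<Longrightarrow> nrm V f = 0 \<Longrightarrow> f = 0"
    using closed_span_subset nrm_eq_0D by blast
qed

end

section \<open>Biorthogonal systems with contractive coordinate projections\<close>

text \<open>An axiomatization that fits twice: the unit vectors in m(s), and then their coordinate
  functionals in the dual of Y. The functionals \<beta> and projections \<open>P\<close> live on all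
  of \<open>V\<close>, where the coordinate series of a vector may fail to converge; only on the
  closed span \<open>Y\<close> are they recovered from that series.\<close>

locale projection_system = nspace_normed V
  for V :: "('f::real_normed_field, 'v::ab_group_add) nspace" +
  fixes x :: "nat \<Rightarrow> 'v" and \<beta> :: "nat \<Rightarrow> 'v \<Rightarrow> 'f" and P :: "nat set \<Rightarrow> 'v \<Rightarrow> 'v"
  assumes x_mem: "x j \<in> vecs V"
    and \<beta>_mem: "\<beta> j \<in> vecs (dual V)"
    and \<beta>_x: "\<beta> j (x i) = (if i = j then 1 else 0)"
    and P_mem: "f \<in> vecs V \<Longrightarrow> P A f \<in> vecs V"
    and P_add: "f \<in> vecs V \<Longrightarrow> g \<in> vecs V \<Longrightarrow> P A (f + g) = P A f + P A g"
    and P_smul: "f \<in> vecs V \<Longrightarrow> P A (smul V c f) = smul V c (P A f)"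
    and nrm_P_le: "f \<in> vecs V \<Longrightarrow> nrm V (P A f) \<le> nrm V f"
    and P_UNIV: "f \<in> vecs V \<Longrightarrow> P UNIV f = f"
    and P_Int: "f \<in> vecs V \<Longrightarrow> P A (P B f) = P (A \<inter> B) f"
    and P_finite: "f \<in> vecs V \<Longrightarrow> finite F \<Longrightarrow> P F f = (\<Sum>j\<in>F. smul V (\<beta> j f) (x j))"
begin

abbreviation Y where "Y \<equiv> closed_span V (range x)"

lemma range_x: "range x \<subseteq> vecs V"
  using x_mem by auto

sublocale Y: nspace_normed Y
  by (rule closed_span_normed[OF range_x])

sublocale dual_Y: nspace_normed "dual Y"
  by (rule Y.dual_normed)

lemma smul_Y [simp]: "smul Y = smul V" and nrm_Y [simp]: "nrm Y = nrm V"
  by (simp_all add: closed_span_simps)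

lemma Y_mem: "f \<in> vecs Y \<Longrightarrow> f \<in> vecs V"
  using closed_span_subset by blast

lemma x_in_Y: "x j \<in> vecs Y"
  using span_subset_closed_span[OF range_x] span_base by blast

lemma P_diff: "f \<in> vecs V \<Longrightarrow> g \<in> vecs V \<Longrightarrow> P A (f - g) = P A f - P A g"
  using P_add[of "f - g" g A] diff_mem[of f g] by (simp add: algebra_simps)

lemma P_singleton: "f \<in> vecs V \<Longrightarrow> P {j} f = smul V (\<beta> j f) (x j)"
  using P_finite[of f "{j}"] by simp

lemma P_x: "P A (x j) = (if j \<in> A then x j else 0)"
proof -
  have "P {j} (x j) = x j"
    using x_mem by (simp add: P_singleton \<beta>_x)
  then have "P A (x j) = P (A \<inter> {j}) (x j)"
    using P_Int[OF x_mem, of A "{j}" j] by simp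
  then show ?thesis
    using x_mem by (auto simp: P_singleton P_finite \<beta>_x)
qed

text \<open>The vectors fixed by some finite projection form a subspace containing every
  \<open>x j\<close>.\<close>

lemma span_finite_support:
  assumes "y \<in> span (range x)"
  shows "\<exists>F. finite F \<and> P F y = y"
proof -
  let ?D = "{y \<in> vecs V. \<exists>F. finite F \<and> P F y = y}"
  have "subspace ?D"
    unfolding subspace_def
  proof (intro conjI ballI allI)
    show "0 \<in> ?D"
      using zero_mem by (auto intro!: exI[of _ "{}"] simp: P_finite)
  next
    fix y z assume "y \<in> ?D" "z \<in> ?D"
    then obtain F G where *: "y \<in> vecs V" "z \<in> vecs V" "finite F" "finite G" "P F y = y" "P G z = z"
      by auto
    have "P (F \<union> G) y = y" "P (F \<union> G) z = z"
      using * P_Int[of y "F \<union> G" F] P_Int[of z "F \<union> G" G] by (simp_all add: Int_absorb1)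
    then have "P (F \<union> G) (y + z) = y + z"
      using * by (simp add: P_add)
    then show "y + z \<in> ?D"
      using * add_mem by blast
  next
    fix c y assume "y \<in> ?D"
    then show "smul V c y \<in> ?D"
      using smul_mem P_smul by force
  qed
  moreover have "x j \<in> ?D" for j
    using x_mem by (auto intro!: exI[of _ "{j}"] simp: P_x)
  ultimately have "span (range x) \<subseteq> ?D"
    by (intro span_minimal) auto
  then show ?thesis
    using assms by blast
qed

lemma Y_approx:
  assumes "f \<in> vecs Y" "\<epsilon> > 0"
  obtains F y where "finite F" "y \<in> vecs V" "P F y = y" "nrm V (f - y) < \<epsilon>"
proof -
  obtain y where y: "y \<in> span (range x)" "nrm V (f - y) < \<epsilon>"
    using assms unfolding closed_span_mem_iff by metis
  then show ?thesis
    using span_finite_support[OF y(1)] span_subset_vecs[OF range_x] that by blast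
qed

lemma P_finite_span: "f \<in> vecs V \<Longrightarrow> finite F \<Longrightarrow> P F f \<in> span (range x)"
  by (simp add: P_finite) (intro span_sum span_scale span_base rangeI)

text \<open>If \<open>y\<close> has finite support \<open>F\<close>, then
  \<open>P A y = P (A \<inter> F) y\<close> lies in the span, and contractivity carries the
  approximation of \<open>f\<close> by \<open>y\<close> over to \<open>P A f\<close>.\<close>

lemma P_Y_mem:
  assumes f: "f \<in> vecs Y"
  shows "P A f \<in> vecs Y"
  unfolding closed_span_mem_iff
proof (intro conjI allI impI)
  show "P A f \<in> vecs V"
    using f by (simp add: P_mem Y_mem)
  fix \<epsilon> :: real assume "\<epsilon> > 0"
  then obtain F y where y: "finite F" "y \<in> vecs V" "P F y = y" "nrm V (f - y) < \<epsilon>"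
    using Y_approx[OF f] by metis
  have "P A y = P (A \<inter> F) y"
    using P_Int[OF y(2), of A F] y(3) by simp
  then have "P A y \<in> span (range x)"
    using P_finite_span[OF y(2), of "A \<inter> F"] y(1) by simp
  moreover have "nrm V (P A f - P A y) < \<epsilon>"
    using nrm_P_le[of "f - y" A] y f by (simp add: P_diff diff_mem Y_mem)
  ultimately show "\<exists>g\<in>span (range x). nrm V (P A f - g) < \<epsilon>"
    by blast
qed

lemma smul_x_in_Y: "smul V c (x j) \<in> vecs Y"
  using Y.smul_mem[OF x_in_Y] by simp

text \<open>For \<open>y\<close> supported in \<open>F0\<close> and \<open>F\<close> between
  \<open>F0 \<inter> A\<close> and \<open>A\<close>, the projections \<open>P F\<close> and
  \<open>P A\<close> agree on \<open>y\<close>. Hence \<open>P F f - P A f\<close> only sees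
  \<open>f - y\<close>, once through each contractive projection, whence \<epsilon>/2.\<close>

lemma has_nsum_P:
  assumes f: "f \<in> vecs Y"
  shows "has_nsum Y (\<lambda>j. smul Y (\<beta> j f) (x j)) A (P A f)"
  unfolding has_nsum_def nrm_Y smul_Y
proof (intro conjI P_Y_mem[OF f] tendstoI)
  note fV = Y_mem[OF f]
  fix \<epsilon> :: real assume "\<epsilon> > 0"
  then have "\<epsilon> / 2 > 0" by simp
  then obtain F0 y where y: "finite F0" "y \<in> vecs V" "P F0 y = y" "nrm V (f - y) < \<epsilon> / 2"
    using Y_approx[OF f] by metis
  have "dist (nrm V ((\<Sum>j\<in>F. smul V (\<beta> j f) (x j)) - P A f)) 0 < \<epsilon>"
    if F: "finite F" "F0 \<inter> A \<subseteq> F" "F \<subseteq> A" for F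
  proof -
    have "P F y = P (F \<inter> F0) y" "P A y = P (A \<inter> F0) y"
      using P_Int[OF y(2), of _ F0] y(3) by simp_all
    moreover have "F \<inter> F0 = A \<inter> F0"
      using F by auto
    ultimately have "P F f - P A f = P F (f - y) - P A (f - y)"
      using y(2) fV by (simp add: P_diff)
    then have "nrm V (P F f - P A f) \<le> nrm V (P F (f - y)) + nrm V (P A (f - y))"
      using y(2) fV by (simp add: nrm_diff_le P_mem diff_mem)
    also have "\<dots> < \<epsilon>"
      using nrm_P_le[of "f - y" F] nrm_P_le[of "f - y" A] y fV by (simp add: diff_mem)
    finally show ?thesis
      using F fV nrm_nonneg[of "P F f - P A f"] by (simp add: P_finite[symmetric] P_mem diff_mem)
  qed
  then show "eventually (\<lambda>F. dist (nrm V ((\<Sum>j\<in>F. smul V (\<beta> j f) (x j)) - P A f)) 0 < \<epsilon>)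
    (finite_subsets_at_top A)"
    unfolding eventually_finite_subsets_at_top using y(1)
    by (intro exI[of _ "F0 \<inter> A"]) auto
qed

text \<open>The restriction of \<open>\<beta> j\<close> to the closed span, put to 0 elsewhere
  because elements of \<open>dual\<close> must vanish outside the carrier.\<close>

definition biorth :: "nat \<Rightarrow> 'v \<Rightarrow> 'f" where
  "biorth j f = (if f \<in> vecs Y then \<beta> j f else 0)"

lemma biorth_mem: "biorth j \<in> vecs (dual Y)"
proof (rule Y.dual_memI)
  fix f assume "f \<in> vecs Y"
  then show "norm (biorth j f) \<le> nrm (dual V) (\<beta> j) * nrm Y f"
    using dual_apply_le[OF \<beta>_mem, of f j] by (simp add: biorth_def Y_mem)
next
  fix f c assume "f \<in> vecs Y"
  then show "biorth j (smul Y c f) = c * biorth j f"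
    using Y.smul_mem[of f c] dual_smul[OF \<beta>_mem, of f j c] by (simp add: biorth_def Y_mem)
qed (auto simp: biorth_def Y.add_mem dual_add[OF \<beta>_mem] Y_mem)

text \<open>Existence of the expansion is \<open>has_nsum_P\<close> on the full index set; applying
  \<open>biorth j\<close> to any other expansion identifies its coefficients. This evaluates the
  description in \<open>coord\<close>.\<close>

lemma coord_eq: "coord Y x = biorth"
proof (intro ext)
  fix j f
  show "coord Y x j f = biorth j f"
  proof (cases "f \<in> vecs Y")
    case f: True
    have "(THE a. has_nsum Y (\<lambda>i. smul Y (a i) (x i)) UNIV f) = (\<lambda>j. \<beta> j f)"
    proof (rule the_equality)
      show "has_nsum Y (\<lambda>i. smul Y (\<beta> i f) (x i)) UNIV f"
        using has_nsum_P[OF f, of UNIV] P_UNIV[OF Y_mem[OF f]] by simp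
      fix a assume a: "has_nsum Y (\<lambda>i. smul Y (a i) (x i)) UNIV f"
      show "a = (\<lambda>j. \<beta> j f)"
      proof
        fix j
        have "((\<lambda>F. \<Sum>i\<in>F. biorth j (smul Y (a i) (x i))) \<longlongrightarrow> biorth j f) (finite_subsets_at_top UNIV)"
          using a by (intro Y.dual_tendsto biorth_mem) (auto simp: smul_x_in_Y)
        moreover have "biorth j (smul Y (a i) (x i)) = (if i = j then a j else 0)" for i
          using dual_smul[OF \<beta>_mem x_mem] by (simp add: biorth_def smul_x_in_Y \<beta>_x)
        ultimately have 1: "((\<lambda>F. \<Sum>i\<in>F. if i = j then a j else 0) \<longlongrightarrow> \<beta> j f) (finite_subsets_at_top UNIV)"
          using f by (simp add: biorth_def)
        have 2: "((\<lambda>F. \<Sum>i\<in>F. if i = j then a j else 0) \<longlongrightarrow> a j) (finite_subsets_at_top UNIV)"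
          by (rule tendsto_eventually, unfold eventually_finite_subsets_at_top,
              rule exI[of _ "{j}"]) auto
        show "a j = \<beta> j f"
          by (rule tendsto_unique[OF _ 2 1]) simp
      qed
    qed
    then show ?thesis
      using f by (simp add: coord_def biorth_def)
  qed (simp add: coord_def biorth_def)
qed

lemma coord_proj_eq:
  assumes f: "f \<in> vecs Y"
  shows "coord_proj Y x A f = P A f"
  unfolding coord_proj_def coord_eq
proof (rule the_equality)
  show nsum: "has_nsum Y (\<lambda>j. smul Y (biorth j f) (x j)) A (P A f)"
    using has_nsum_P[OF f] f by (simp add: biorth_def)
  show "g = P A f" if "has_nsum Y (\<lambda>j. smul Y (biorth j f) (x j)) A g" for g
    by (rule Y.has_nsum_unique[OF _ that nsum]) (simp add: smul_x_in_Y)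
qed

lemma adjoint_coord_proj: "adjoint Y (coord_proj Y x A) = adjoint Y (P A)"
  by (auto simp: adjoint_def coord_proj_eq fun_eq_iff)

section \<open>Adjoint projections and the dual system\<close>

lemma adjoint_P_apply_le:
  assumes "\<phi> \<in> vecs (dual Y)" "f \<in> vecs Y"
  shows "norm (adjoint Y (P A) \<phi> f) \<le> nrm (dual Y) \<phi> * nrm Y f"
proof -
  have "norm (\<phi> (P A f)) \<le> nrm (dual Y) \<phi> * nrm Y (P A f)"
    by (rule Y.dual_apply_le[OF assms(1) P_Y_mem[OF assms(2)]])
  also have "\<dots> \<le> nrm (dual Y) \<phi> * nrm Y f"
    using nrm_P_le[OF Y_mem[OF assms(2)]] Y.nrm_dual_nonneg[OF assms(1)] by (simp add: mult_left_mono)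
  finally show ?thesis
    using assms(2) by (simp add: adjoint_def)
qed

lemma adjoint_P_mem:
  assumes \<phi>: "\<phi> \<in> vecs (dual Y)"
  shows "adjoint Y (P A) \<phi> \<in> vecs (dual Y)"
proof (rule Y.dual_memI[OF _ _ adjoint_P_apply_le[OF \<phi>]])
  fix f g assume fg: "f \<in> vecs Y" "g \<in> vecs Y"
  show "adjoint Y (P A) \<phi> (f + g) = adjoint Y (P A) \<phi> f + adjoint Y (P A) \<phi> g"
    using fg by (simp add: adjoint_def Y.add_mem P_add Y_mem Y.dual_add[OF \<phi>] P_Y_mem)
next
  fix f c assume f: "f \<in> vecs Y"
  have "\<phi> (smul V c (P A f)) = c * \<phi> (P A f)"
    using Y.dual_smul[OF \<phi> P_Y_mem[OF f]] by simp
  then show "adjoint Y (P A) \<phi> (smul Y c f) = c * adjoint Y (P A) \<phi> f"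
    using f Y.smul_mem[OF f, of c] by (simp add: adjoint_def P_smul Y_mem)
qed (auto simp: adjoint_def)

lemma nrm_adjoint_P_le:
  "\<phi> \<in> vecs (dual Y) \<Longrightarrow> nrm (dual Y) (adjoint Y (P A) \<phi>) \<le> nrm (dual Y) \<phi>"
  by (intro Y.nrm_dual_le Y.nrm_dual_nonneg adjoint_P_apply_le)

lemma adjoint_P_x: "adjoint Y (P A) \<phi> (x j) = (if j \<in> A then \<phi> (x j) else \<phi> 0)"
  by (simp add: adjoint_def x_in_Y P_x)

text \<open>The canonical image of \<open>x j\<close> in the bidual of \<open>Y\<close>; it takes
  the place of \<open>\<beta> j\<close> in the dual system.\<close>

definition eval :: "nat \<Rightarrow> ('v \<Rightarrow> 'f) \<Rightarrow> 'f" where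
  "eval j \<phi> = (if \<phi> \<in> vecs (dual Y) then \<phi> (x j) else 0)"

lemma eval_mem: "eval j \<in> vecs (dual (dual Y))"
proof (rule dual_Y.dual_memI)
  fix \<phi> assume \<phi>: "\<phi> \<in> vecs (dual Y)"
  then show "norm (eval j \<phi>) \<le> nrm V (x j) * nrm (dual Y) \<phi>"
    using Y.dual_apply_le[OF \<phi> x_in_Y, of j] by (simp add: eval_def mult.commute)
next
  fix \<phi> c assume \<phi>: "\<phi> \<in> vecs (dual Y)"
  then show "eval j (smul (dual Y) c \<phi>) = c * eval j \<phi>"
    using dual_Y.smul_mem[OF \<phi>, of c] by (simp add: eval_def) (simp add: Y.smul_dual)
qed (auto simp: eval_def dual_Y.add_mem)

text \<open>The axioms are stable under duality, so \<open>coord_eq\<close> and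
  \<open>coord_proj_eq\<close> can be used again for the second closed span in
  \<open>lechner\<close>. Adjoints reverse the order of composition, which is harmless because
  intersection commutes.\<close>

lemma projection_system_dual:
  "projection_system (dual Y) biorth eval (\<lambda>A. adjoint Y (P A))"
proof (rule projection_system.intro[OF dual_Y.nspace_normed_axioms], unfold_locales)
  fix j i A B f g and c :: 'f and F :: "nat set"
  show "biorth j \<in> vecs (dual Y)"
    by (rule biorth_mem)
  show "eval j \<in> vecs (dual (dual Y))"
    by (rule eval_mem)
  show "eval j (biorth i) = (if i = j then 1 else 0)"
    by (simp add: eval_def biorth_mem) (simp add: biorth_def x_in_Y \<beta>_x)
  assume f: "f \<in> vecs (dual Y)"
  show "adjoint Y (P A) f \<in> vecs (dual Y)"
    by (rule adjoint_P_mem[OF f])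
  show "adjoint Y (P A) (smul (dual Y) c f) = smul (dual Y) c (adjoint Y (P A) f)"
    by (auto simp: adjoint_def Y.smul_dual fun_eq_iff)
  show "nrm (dual Y) (adjoint Y (P A) f) \<le> nrm (dual Y) f"
    by (rule nrm_adjoint_P_le[OF f])
  show "adjoint Y (P UNIV) f = f"
    using Y.dual_outside[OF f] by (auto simp: adjoint_def fun_eq_iff P_UNIV Y_mem)
  show "adjoint Y (P A) (adjoint Y (P B) f) = adjoint Y (P (A \<inter> B)) f"
    by (auto simp: adjoint_def fun_eq_iff P_Y_mem P_Int Y_mem Int_commute)
  show "adjoint Y (P A) (f + g) = adjoint Y (P A) f + adjoint Y (P A) g"
    by (auto simp: adjoint_def fun_eq_iff)
  assume F: "finite F"
  show "adjoint Y (P F) f = (\<Sum>j\<in>F. smul (dual Y) (eval j f) (biorth j))"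
  proof
    fix u
    have "f (P F u) = (\<Sum>j\<in>F. f (x j) * \<beta> j u)" if u: "u \<in> vecs Y"
    proof -
      have "f (P F u) = (\<Sum>j\<in>F. f (smul Y (\<beta> j u) (x j)))"
        using Y.dual_sum[OF f, of F "\<lambda>j. smul V (\<beta> j u) (x j)"] P_finite[OF Y_mem[OF u] F]
        by (simp add: smul_x_in_Y)
      then show ?thesis
        by (simp only: Y.dual_smul[OF f x_in_Y] mult.commute)
    qed
    moreover have "(\<Sum>j\<in>F. smul (dual Y) (eval j f) (biorth j)) u = (\<Sum>j\<in>F. eval j f * biorth j u)"
      using F by (induction F) (auto simp: Y.smul_dual)
    ultimately show "adjoint Y (P F) f u = (\<Sum>j\<in>F. smul (dual Y) (eval j f) (biorth j)) u"
      by (auto simp: adjoint_def eval_def f biorth_def)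
  qed
qed

end

section \<open>Marcinkiewicz spaces\<close>

text \<open>The conjugate phase of \<open>z\<close>, written so as to make sense in any real normed
  field. Division by zero makes it 0 at \<open>z = 0\<close>, and \<open>unimod_mult\<close> holds
  there too.\<close>

definition unimod :: "'f::real_normed_field \<Rightarrow> 'f" where
  "unimod z = of_real (norm z) / z"

lemma norm_unimod_le: "norm (unimod z) \<le> 1"
  by (simp add: unimod_def norm_divide)

lemma unimod_mult: "unimod z * z = of_real (norm z)"
  by (simp add: unimod_def)

text \<open>Taking \<open>M\<close> as a parameter fixes the scalar type throughout. Completeness of
  the scalars lets the absolutely convergent series in \<open>functional\<close> converge.\<close>

locale marcinkiewicz_space =
  fixes s :: "nat \<Rightarrow> real" and M :: "('f::{real_normed_field,banach}, nat \<Rightarrow> 'f) nspace"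
  assumes weight_s: "weight s" and mono_s: "mono_on {1..} s" and M_eq: "M = marcinkiewicz s"
begin

lemma s_pos: "1 \<le> n \<Longrightarrow> 0 < s n"
  using weight_s by (simp add: weight_def)

lemma s_card_pos: "finite A \<Longrightarrow> A \<noteq> {} \<Longrightarrow> 0 < s (card A)"
  using s_pos[of "card A"] by (simp add: Suc_le_eq card_gt_0_iff)

lemma smul_M: "smul M = (\<lambda>c f j. c * f j)"
  by (simp add: M_eq marcinkiewicz_def)

text \<open>Since \<open>n = card A\<close>, the condition \<open>n \<ge> 1\<close> says that
  \<open>A\<close> is nonempty, and the supremum has a single index.\<close>

lemma averages_eq:
  "marcinkiewicz_averages s f = (\<lambda>A. (\<Sum>j\<in>A. norm (f j)) / s (card A)) ` {A. finite A \<and> A \<noteq> {}}"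
  by (auto simp: marcinkiewicz_averages_def image_def Suc_le_eq card_gt_0_iff)

lemma sum_le:
  assumes "f \<in> vecs M" "finite A" "A \<noteq> {}"
  shows "(\<Sum>j\<in>A. norm (f j)) \<le> nrm M f * s (card A)"
proof -
  have "(\<Sum>j\<in>A. norm (f j)) / s (card A) \<le> nrm M f"
    using assms by (auto simp: M_eq marcinkiewicz_def averages_eq intro!: cSUP_upper)
  then show ?thesis
    using s_card_pos[OF assms(2,3)] by (simp add: field_simps)
qed

lemma
  assumes "\<And>A. finite A \<Longrightarrow> A \<noteq> {} \<Longrightarrow> (\<Sum>j\<in>A. norm (f j)) \<le> C * s (card A)"
  shows memI: "f \<in> vecs M" and nrm_le: "nrm M f \<le> C"
proof -
  have le: "(\<Sum>j\<in>A. norm (f j)) / s (card A) \<le> C" if "finite A" "A \<noteq> {}" for A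
    using assms[OF that] s_card_pos[OF that] by (simp add: field_simps)
  then show "f \<in> vecs M"
    by (auto simp: M_eq marcinkiewicz_def averages_eq intro!: bdd_aboveI2)
  have "{A :: nat set. finite A \<and> A \<noteq> {}} \<noteq> {}"
    by blast
  then show "nrm M f \<le> C"
    using le by (auto simp: M_eq marcinkiewicz_def averages_eq intro!: cSUP_least)
qed

lemma M_solid:
  assumes "f \<in> vecs M" "\<And>j. norm (g j) \<le> norm (f j)"
  shows "g \<in> vecs M" "nrm M g \<le> nrm M f"
proof -
  have "(\<Sum>j\<in>A. norm (g j)) \<le> nrm M f * s (card A)" if "finite A" "A \<noteq> {}" for A
    using sum_le[OF assms(1) that] sum_mono[of A "\<lambda>j. norm (g j)" "\<lambda>j. norm (f j)"] assms(2) by force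
  then show "g \<in> vecs M" "nrm M g \<le> nrm M f"
    by (auto intro: memI nrm_le)
qed

sublocale nspace_normed M
proof
  show "\<And>c f g. smul M c (f + g) = smul M c f + smul M c g"
    "\<And>c d f. smul M (c + d) f = smul M c f + smul M d f"
    "\<And>c d f. smul M c (smul M d f) = smul M (c * d) f"
    "\<And>f. smul M 1 f = f"
    by (auto simp: smul_M algebra_simps fun_eq_iff)
  show "0 \<in> vecs M"
    by (rule memI[where C = 0]) auto
next
  fix f g assume fg: "f \<in> vecs M" "g \<in> vecs M"
  have le: "(\<Sum>j\<in>A. norm ((f + g) j)) \<le> (nrm M f + nrm M g) * s (card A)"
    if "finite A" "A \<noteq> {}" for A
  proof -
    have "(\<Sum>j\<in>A. norm ((f + g) j)) \<le> (\<Sum>j\<in>A. norm (f j)) + (\<Sum>j\<in>A. norm (g j))"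
      by (auto simp: sum.distrib[symmetric] intro!: sum_mono norm_triangle_ineq)
    then show ?thesis
      using sum_le[OF fg(1) that] sum_le[OF fg(2) that] by (simp add: distrib_right)
  qed
  show "f + g \<in> vecs M" "nrm M (f + g) \<le> nrm M f + nrm M g"
    by (rule memI[OF le] nrm_le[OF le]; assumption)+
next
  fix f c assume f: "f \<in> vecs M"
  have le: "(\<Sum>j\<in>A. norm (smul M c f j)) \<le> (norm c * nrm M f) * s (card A)"
    if "finite A" "A \<noteq> {}" for A
    using sum_le[OF f that]
    by (simp add: smul_M norm_mult sum_distrib_left[symmetric] mult.assoc mult_left_mono)
  show "smul M c f \<in> vecs M" "nrm M (smul M c f) \<le> norm c * nrm M f"
    by (rule memI[OF le] nrm_le[OF le]; assumption)+
next
  fix f assume f: "f \<in> vecs M" "nrm M f = 0"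
  then have "norm (f j) \<le> 0" for j
    using sum_le[OF f(1), of "{j}"] by simp
  then show "f = 0"
    by (simp add: fun_eq_iff)
qed

definition coordinate :: "nat \<Rightarrow> (nat \<Rightarrow> 'f) \<Rightarrow> 'f" where
  "coordinate j f = (if f \<in> vecs M then f j else 0)"

definition trunc :: "nat set \<Rightarrow> (nat \<Rightarrow> 'f) \<Rightarrow> nat \<Rightarrow> 'f" where
  "trunc A f j = (if j \<in> A then f j else 0)"

lemma sum_smul_unit_vector:
  "finite F \<Longrightarrow> (\<Sum>j\<in>F. smul M (a j) (unit_vector j)) i = (if i \<in> F then a i else 0)"
  by (induction F rule: finite_induct) (auto simp: smul_M unit_vector_def)

text \<open>Monotonicity of \<open>s\<close> gives the bound \<open>1 / s 1\<close>.\<close>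

lemma unit_vector_mem: "unit_vector j \<in> vecs M"
proof (rule memI)
  fix A :: "nat set" assume A: "finite A" "A \<noteq> {}"
  then have "1 \<le> card A"
    by (simp add: Suc_le_eq card_gt_0_iff)
  then have "s 1 \<le> s (card A)"
    by (intro mono_onD[OF mono_s]) auto
  then have "1 \<le> (1 / s 1) * s (card A)"
    using s_pos[of 1] by simp
  moreover have "(\<Sum>k\<in>A. norm (unit_vector j k :: 'f)) \<le> 1"
    using A by (simp add: unit_vector_def if_distrib[of norm] sum.delta cong: if_cong)
  ultimately show "(\<Sum>k\<in>A. norm (unit_vector j k :: 'f)) \<le> (1 / s 1) * s (card A)"
    by linarith
qed

text \<open>\<open>E.Y\<close> is the space Y of the introduction.\<close>

sublocale E: projection_system M unit_vector coordinate trunc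
proof unfold_locales
  fix j i A B f g and c :: 'f and F :: "nat set"
  show "unit_vector j \<in> vecs M"
    by (rule unit_vector_mem)
  show "coordinate j \<in> vecs (dual M)"
  proof (rule dual_memI)
    fix f assume f: "f \<in> vecs M"
    show "norm (coordinate j f) \<le> s 1 * nrm M f"
      using sum_le[OF f, of "{j}"] f by (simp add: coordinate_def mult.commute)
  next
    fix f and c :: 'f assume "f \<in> vecs M"
    then show "coordinate j (smul M c f) = c * coordinate j f"
      using smul_mem[of f c] by (simp add: coordinate_def) (simp add: smul_M)
  qed (auto simp: coordinate_def add_mem)
  show "coordinate j (unit_vector i) = (if i = j then 1 else 0)"
    by (auto simp: coordinate_def unit_vector_mem) (auto simp: unit_vector_def)
  assume f: "f \<in> vecs M"
  show "trunc A f \<in> vecs M" "nrm M (trunc A f) \<le> nrm M f"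
    by (rule M_solid[OF f]; simp add: trunc_def)+
  show "trunc A (smul M c f) = smul M c (trunc A f)" "trunc UNIV f = f"
    "trunc A (trunc B f) = trunc (A \<inter> B) f" "trunc A (f + g) = trunc A f + trunc A g"
    by (auto simp: trunc_def smul_M fun_eq_iff)
  show "trunc F f = (\<Sum>j\<in>F. smul M (coordinate j f) (unit_vector j))" if "finite F"
    using that f by (auto simp: fun_eq_iff trunc_def sum_smul_unit_vector coordinate_def)
qed

text \<open>\<open>D.Y\<close> is the space X of the introduction, so \<open>dual D.Y\<close> is
  X*.\<close>

sublocale D: projection_system "dual E.Y" E.biorth E.eval "\<lambda>A. adjoint E.Y (trunc A)"
  by (rule E.projection_system_dual)

lemma biorth_apply: "f \<in> vecs E.Y \<Longrightarrow> E.biorth j f = f j"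
  by (simp add: E.biorth_def coordinate_def E.Y_mem)

lemma D_eval_eq: "\<xi> \<in> vecs D.Y \<Longrightarrow> E.eval j \<xi> = \<xi> (unit_vector j)"
  by (simp add: E.eval_def D.Y_mem)

text \<open>The innermost existential statement of Lechner's condition, with the coordinate
  projections already replaced by adjoint truncations.\<close>

definition small_combination ::
    "(nat \<Rightarrow> nat set) \<Rightarrow> (nat \<Rightarrow> ((nat \<Rightarrow> 'f) \<Rightarrow> 'f) \<Rightarrow> 'f) \<Rightarrow> real \<Rightarrow> bool" where
  "small_combination B \<phi> \<theta> \<longleftrightarrow>
    (\<exists>a g. (\<lambda>n. norm (a n)) sums 1 \<and>
       has_nsum (dual D.Y)
         (\<lambda>n. smul (dual D.Y) (a n) (adjoint D.Y (adjoint E.Y (trunc (B n))) (\<phi> n))) UNIV g \<and>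
       nrm (dual D.Y) g \<le> \<theta>)"

lemma lechner_iff: "lechner M unit_vector \<longleftrightarrow>
  (\<forall>A. infinite A \<longrightarrow> (\<forall>\<theta>>0.
     \<exists>B :: nat \<Rightarrow> nat set. disjoint_family B \<and> (\<forall>n. infinite (B n) \<and> B n \<subseteq> A) \<and>
       (\<forall>\<phi>. (\<forall>n. \<phi> n \<in> vecs (dual D.Y) \<and> nrm (dual D.Y) (\<phi> n) \<le> 1) \<longrightarrow>
         small_combination B \<phi> \<theta>)))"
  unfolding lechner_def Let_def lechner_dual_def E.coord_eq D.adjoint_coord_proj small_combination_def ..

section \<open>The isometry between X* and m(s)\<close>

lemma pairing_le:
  assumes t: "\<And>S. finite S \<Longrightarrow> S \<noteq> {} \<Longrightarrow> (\<Sum>j\<in>S. norm (t j :: 'f)) \<le> C * s (card S)"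
    and \<xi>: "\<xi> \<in> vecs (dual E.Y)" and F: "finite F"
  shows "(\<Sum>j\<in>F. norm (\<xi> (unit_vector j) * t j)) \<le> C * nrm (dual E.Y) \<xi>"
proof -
  \<comment> \<open>The phases are chosen so that every term of \<open>\<xi> f\<close> is
    nonnegative, while \<open>norm (c j) \<le> norm (t j)\<close> keeps the norm of \<open>f\<close>
    in m(s) at most \<open>C\<close>.\<close>
  define c where "c j = unimod (\<xi> (unit_vector j)) * of_real (norm (t j))" for j
  define f where "f = (\<Sum>j\<in>F. smul M (c j) (unit_vector j))"
  have f_Y: "f \<in> vecs E.Y"
    unfolding f_def by (intro E.Y.sum_mem E.smul_x_in_Y)
  have c_le: "norm (c j) \<le> norm (t j)" for j
    using norm_unimod_le[of "\<xi> (unit_vector j)"] by (simp add: c_def norm_mult mult_left_le_one_le)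
  have "nrm M f \<le> C"
  proof (rule nrm_le)
    fix A :: "nat set" assume A: "finite A" "A \<noteq> {}"
    have "(\<Sum>j\<in>A. norm (f j)) \<le> (\<Sum>j\<in>A. norm (t j))"
      using c_le by (intro sum_mono) (auto simp: f_def sum_smul_unit_vector[OF F])
    then show "(\<Sum>j\<in>A. norm (f j)) \<le> C * s (card A)"
      using t[OF A] by simp
  qed
  then have "norm (\<xi> f) \<le> nrm (dual E.Y) \<xi> * C"
    using E.Y.dual_apply_le[OF \<xi> f_Y] E.Y.nrm_dual_nonneg[OF \<xi>]
    by (simp add: mult_left_mono order_trans)
  have "\<xi> f = (\<Sum>j\<in>F. \<xi> (smul E.Y (c j) (unit_vector j)))"
    unfolding f_def using E.Y.dual_sum[OF \<xi>, of F "\<lambda>j. smul M (c j) (unit_vector j)"]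
    by (simp add: E.smul_x_in_Y)
  also have "\<dots> = (\<Sum>j\<in>F. c j * \<xi> (unit_vector j))"
    by (simp only: E.Y.dual_smul[OF \<xi> E.x_in_Y])
  also have "\<dots> = of_real (\<Sum>j\<in>F. norm (\<xi> (unit_vector j) * t j))"
    unfolding of_real_sum
  proof (rule sum.cong)
    fix j
    have "c j * \<xi> (unit_vector j) =
        (unimod (\<xi> (unit_vector j)) * \<xi> (unit_vector j)) * of_real (norm (t j))"
      by (simp add: c_def ac_simps)
    then show "c j * \<xi> (unit_vector j) = of_real (norm (\<xi> (unit_vector j) * t j))"
      by (simp add: unimod_mult norm_mult)
  qed simp
  finally have "norm (\<xi> f) = (\<Sum>j\<in>F. norm (\<xi> (unit_vector j) * t j))"
    by (simp add: sum_nonneg del: of_real_sum)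
  then show ?thesis
    using \<open>norm (\<xi> f) \<le> nrm (dual E.Y) \<xi> * C\<close> by (simp add: mult.commute)
qed

text \<open>Testing \<phi> on the sum over \<open>S\<close> of coordinate functionals with matching
  phases gives the left side, and by the definition of the norm of m(s) this test vector has norm at
  most \<open>s (card S)\<close> in Y*.\<close>

lemma dual_coordinates_sum_le:
  assumes \<phi>: "\<phi> \<in> vecs (dual D.Y)" and S: "finite S" "S \<noteq> {}"
  shows "(\<Sum>j\<in>S. norm (\<phi> (E.biorth j))) \<le> nrm (dual D.Y) \<phi> * s (card S)"
proof -
  define \<xi> where "\<xi> = (\<Sum>j\<in>S. smul (dual E.Y) (unimod (\<phi> (E.biorth j))) (E.biorth j))"
  have \<xi>_mem: "\<xi> \<in> vecs D.Y"
    unfolding \<xi>_def by (intro D.Y.sum_mem D.smul_x_in_Y)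
  have \<xi>_apply: "\<xi> f = (\<Sum>j\<in>S. unimod (\<phi> (E.biorth j)) * E.biorth j f)" for f
    unfolding \<xi>_def using S(1) by (induction S) (auto simp: E.Y.smul_dual)
  have "nrm (dual E.Y) \<xi> \<le> s (card S)"
  proof (rule E.Y.nrm_dual_le)
    fix f assume f: "f \<in> vecs E.Y"
    have "norm (\<xi> f) \<le> (\<Sum>j\<in>S. norm (unimod (\<phi> (E.biorth j)) * f j))"
      unfolding \<xi>_apply using f by (simp add: biorth_apply sum_norm_le)
    also have "\<dots> \<le> (\<Sum>j\<in>S. norm (f j))"
      by (intro sum_mono) (simp add: norm_mult mult_left_le_one_le norm_unimod_le)
    also have "\<dots> \<le> nrm M f * s (card S)"
      by (rule sum_le[OF E.Y_mem[OF f] S])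
    finally show "norm (\<xi> f) \<le> s (card S) * nrm E.Y f"
      by (simp add: mult.commute)
  qed (use s_card_pos[OF S] in simp)
  then have "norm (\<phi> \<xi>) \<le> nrm (dual D.Y) \<phi> * s (card S)"
    using D.Y.dual_apply_le[OF \<phi> \<xi>_mem] D.Y.nrm_dual_nonneg[OF \<phi>]
    by (simp add: mult_left_mono order_trans)
  have "\<phi> \<xi> = (\<Sum>j\<in>S. \<phi> (smul D.Y (unimod (\<phi> (E.biorth j))) (E.biorth j)))"
    using D.Y.dual_sum[OF \<phi>, of S "\<lambda>j. smul (dual E.Y) (unimod (\<phi> (E.biorth j))) (E.biorth j)"]
    by (simp add: \<xi>_def D.smul_x_in_Y)
  also have "\<dots> = of_real (\<Sum>j\<in>S. norm (\<phi> (E.biorth j)))"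
    by (simp only: D.Y.dual_smul[OF \<phi> D.x_in_Y] unimod_mult of_real_sum)
  finally have "norm (\<phi> \<xi>) = (\<Sum>j\<in>S. norm (\<phi> (E.biorth j)))"
    by (simp add: sum_nonneg del: of_real_sum)
  then show ?thesis
    using \<open>norm (\<phi> \<xi>) \<le> nrm (dual D.Y) \<phi> * s (card S)\<close> by simp
qed

text \<open>Each \<xi> in X is the unordered sum of its coordinate expansion, so \<phi> \<xi> is a
  limit of finite pairings, which \<open>pairing_le\<close> bounds with the coordinates of \<phi> in
  the place of \<open>t\<close>.\<close>

lemma nrm_dual_le_coordinates:
  assumes \<phi>: "\<phi> \<in> vecs (dual D.Y)"
    and le: "\<And>S. finite S \<Longrightarrow> S \<noteq> {} \<Longrightarrow> (\<Sum>j\<in>S. norm (\<phi> (E.biorth j))) \<le> C * s (card S)"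
  shows "nrm (dual D.Y) \<phi> \<le> C"
proof (rule D.Y.nrm_dual_le)
  have "0 \<le> C * s 1"
    using order_trans[OF norm_ge_zero[of "\<phi> (E.biorth 0)"]] le[of "{0}"] by simp
  then show "0 \<le> C"
    using s_pos[of 1] by (simp add: zero_le_mult_iff)
  fix \<xi> assume \<xi>: "\<xi> \<in> vecs D.Y"
  have "((\<lambda>F. \<Sum>j\<in>F. \<phi> (smul D.Y (E.eval j \<xi>) (E.biorth j))) \<longlongrightarrow> \<phi> \<xi>) (finite_subsets_at_top UNIV)"
    using D.has_nsum_P[OF \<xi>, of UNIV] D.P_UNIV[OF D.Y_mem[OF \<xi>]]
    by (intro D.Y.dual_tendsto[OF \<phi>]) (auto simp: D.smul_x_in_Y)
  then have lim: "((\<lambda>F. \<Sum>j\<in>F. \<xi> (unit_vector j) * \<phi> (E.biorth j)) \<longlongrightarrow> \<phi> \<xi>) (finite_subsets_at_top UNIV)"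
    by (simp only: D.Y.dual_smul[OF \<phi> D.x_in_Y] D_eval_eq[OF \<xi>])
  have "eventually (\<lambda>F. norm (\<Sum>j\<in>F. \<xi> (unit_vector j) * \<phi> (E.biorth j)) \<le> C * nrm D.Y \<xi>)
    (finite_subsets_at_top UNIV)"
  proof (rule eventually_finite_subsets_at_top_weakI)
    fix F :: "nat set" assume "finite F"
    then show "norm (\<Sum>j\<in>F. \<xi> (unit_vector j) * \<phi> (E.biorth j)) \<le> C * nrm D.Y \<xi>"
      using pairing_le[OF le D.Y_mem[OF \<xi>], of F]
        norm_sum[of "\<lambda>j. \<xi> (unit_vector j) * \<phi> (E.biorth j)" F] by simp
  qed
  then show "norm (\<phi> \<xi>) \<le> C * nrm D.Y \<xi>"
    by (rule tendsto_upperbound[OF tendsto_norm[OF lim]]) simp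
qed

text \<open>The element of X* whose coordinates are a given sequence in m(s); it shows that the
  passage from X* to m(s) is onto.\<close>

definition functional :: "(nat \<Rightarrow> 'f) \<Rightarrow> ((nat \<Rightarrow> 'f) \<Rightarrow> 'f) \<Rightarrow> 'f" where
  "functional t \<xi> = (if \<xi> \<in> vecs D.Y then \<Sum>j. \<xi> (unit_vector j) * t j else 0)"

context
  fixes t :: "nat \<Rightarrow> 'f" and C :: real
  assumes t: "\<And>S. finite S \<Longrightarrow> S \<noteq> {} \<Longrightarrow> (\<Sum>j\<in>S. norm (t j)) \<le> C * s (card S)"
begin

lemma functional_summable:
  "\<xi> \<in> vecs D.Y \<Longrightarrow> summable (\<lambda>j. norm (\<xi> (unit_vector j) * t j))"
  by (rule summableI_nonneg_bounded[where x = "C * nrm D.Y \<xi>"])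
     (use pairing_le[OF t D.Y_mem] in auto)

lemma functional_mem: "functional t \<in> vecs (dual D.Y)"
proof (rule D.Y.dual_memI)
  fix \<xi> assume \<xi>: "\<xi> \<in> vecs D.Y"
  have "norm (functional t \<xi>) \<le> (\<Sum>j. norm (\<xi> (unit_vector j) * t j))"
    using \<xi> functional_summable[OF \<xi>] by (simp add: functional_def summable_norm)
  also have "\<dots> \<le> C * nrm D.Y \<xi>"
    by (rule suminf_le_const[OF functional_summable[OF \<xi>]])
       (use pairing_le[OF t D.Y_mem[OF \<xi>]] in auto)
  finally show "norm (functional t \<xi>) \<le> C * nrm D.Y \<xi>" .
next
  fix \<xi> \<zeta> assume "\<xi> \<in> vecs D.Y" "\<zeta> \<in> vecs D.Y"
  then show "functional t (\<xi> + \<zeta>) = functional t \<xi> + functional t \<zeta>"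
    by (simp add: functional_def D.Y.add_mem distrib_right suminf_add
        functional_summable[THEN summable_norm_cancel])
next
  fix \<xi> c assume \<xi>: "\<xi> \<in> vecs D.Y"
  then show "functional t (smul D.Y c \<xi>) = c * functional t \<xi>"
    using D.Y.smul_mem[OF \<xi>, of c] suminf_mult[OF functional_summable[OF \<xi>, THEN summable_norm_cancel], of c]
    by (simp add: functional_def E.Y.smul_dual mult.assoc)
qed (simp add: functional_def)

lemma functional_biorth: "functional t (E.biorth j) = t j"
proof -
  have "E.biorth j (unit_vector i) * t i = (if i = j then t j else 0)" for i
    by (simp add: biorth_apply E.x_in_Y unit_vector_def)
  then show ?thesis
    using sums_unique[OF sums_single[of j "\<lambda>_. t j"]] by (simp add: functional_def D.x_in_Y)
qed

lemma nrm_functional_le: "nrm (dual D.Y) (functional t) \<le> C"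
  by (rule nrm_dual_le_coordinates[OF functional_mem]) (simp add: functional_biorth t)

end

lemma block_apply_biorth:
  "\<phi> \<in> vecs (dual D.Y) \<Longrightarrow>
    adjoint D.Y (adjoint E.Y (trunc A)) \<phi> (E.biorth j) = (if j \<in> A then \<phi> (E.biorth j) else 0)"
  by (simp add: D.adjoint_P_x D.Y.dual_zero)

end

section \<open>Essentially decreasing weights\<close>

text \<open>The constant \<open>c\<close> will be the infimum in the definition of essential
  decrease, used in a form free of division.\<close>

locale essentially_decreasing_derivative =
  fixes s w :: "nat \<Rightarrow> real" and c :: real
  assumes s_eq: "1 \<le> n \<Longrightarrow> s n = (\<Sum>j=1..n. w j)"
    and w_pos: "1 \<le> n \<Longrightarrow> 0 < w n"
    and c_pos: "0 < c"
    and w_le: "1 \<le> m \<Longrightarrow> m \<le> n \<Longrightarrow> c * w n \<le> w m"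
begin

lemma s_pos: "1 \<le> n \<Longrightarrow> 0 < s n"
  by (auto simp: s_eq intro!: sum_pos w_pos)

lemma s_mono: "1 \<le> m \<Longrightarrow> m \<le> n \<Longrightarrow> s m \<le> s n"
  by (auto simp: s_eq intro!: sum_mono2 less_imp_le[OF w_pos])

lemma c_le_1: "c \<le> 1"
  using w_le[of 1 1] w_pos[of 1] by simp

text \<open>Up to the factor \<open>c\<close>, the averages \<open>s m / m\<close> decrease: every
  \<open>w j\<close> with \<open>j > q\<close> satisfies \<open>c * w j \<le> w i\<close> for all
  \<open>i \<le> q\<close>, so it is at most \<open>1 / c\<close> times the average of the first
  \<open>q\<close> weights.\<close>

lemma quasiconcave:
  assumes "1 \<le> q" "q \<le> m"
  shows "c * q * s m \<le> m * s q"
proof -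
  have le: "c * q * w j \<le> s q" if "q < j" for j
  proof -
    have "c * q * w j = (\<Sum>i=1..q. c * w j)"
      by simp
    also have "\<dots> \<le> (\<Sum>i=1..q. w i)"
      using that by (intro sum_mono w_le) auto
    finally show ?thesis
      using assms by (simp add: s_eq)
  qed
  have "{1..m} = {1..q} \<union> {q<..m}" "{1..q} \<inter> {q<..m} = {}"
    using assms by auto
  then have "s m = s q + (\<Sum>j\<in>{q<..m}. w j)"
    using assms by (simp add: s_eq sum.union_disjoint)
  then have "c * q * s m = c * (q * s q) + (\<Sum>j\<in>{q<..m}. c * q * w j)"
    by (simp add: distrib_left sum_distrib_left mult.assoc)
  also have "\<dots> \<le> q * s q + (\<Sum>j\<in>{q<..m}. s q)"
    using c_le_1 c_pos s_pos[OF assms(1)] le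
    by (intro add_mono sum_mono) (auto intro!: mult_left_le_one_le)
  also have "\<dots> = m * s q"
    using assms by (simp add: of_nat_diff algebra_simps)
  finally show ?thesis .
qed

text \<open>The i-th smallest element of \<open>T\<close> is at least i, so its weight times
  \<open>c\<close> is at most \<open>w i\<close>. Inserting maxima one by one performs this
  comparison.\<close>

lemma sum_w_le:
  assumes "finite T" "T \<subseteq> {1..}" "T \<noteq> {}"
  shows "c * (\<Sum>j\<in>T. w j) \<le> s (card T)"
proof -
  have "c * (\<Sum>j\<in>T. w j) \<le> (\<Sum>j=1..card T. w j)"
    using assms(1,2)
  proof (induction T rule: finite_linorder_max_induct)
    case (insert b A)
    then have "insert b A \<subseteq> {1..b}"
      by (fastforce intro: less_imp_le)
    then have "card (insert b A) \<le> b"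
      using card_mono[of "{1..b}" "insert b A"] by simp
    moreover have b: "b \<notin> A"
      using insert by blast
    ultimately have "c * w b \<le> w (Suc (card A))"
      using insert by (intro w_le) auto
    then show ?case
      using insert b by (simp add: distrib_left)
  qed simp
  moreover have "1 \<le> card T"
    using assms by (simp add: Suc_le_eq card_gt_0_iff)
  ultimately show ?thesis
    by (simp add: s_eq)
qed

text \<open>The summation over \<open>\<kappa> n > 0\<close> keeps the meaningless value \<open>s 0\<close> out.\<close>

lemma sum_split_le:
  assumes N: "1 \<le> N" and k: "1 \<le> k" and \<delta>: "\<And>m. 1 \<le> m \<Longrightarrow> s m \<le> \<delta> * s (m * N)"
    and \<kappa>: "(\<Sum>n<N. \<kappa> n) \<le> k"
  shows "c\<^sup>2 * (\<Sum>n<N. if \<kappa> n = 0 then 0 else s (\<kappa> n)) \<le> 3 * \<delta> * N * s k"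
proof -
  define h where "h m = (if m = 0 then 0 else s m)" for m :: nat
  have \<delta>_nonneg: "0 \<le> \<delta>"
    using \<delta>[of 1] s_pos[of 1] s_pos[of N] N by (smt (verit) le_numeral_extra(4) mult_1 mult_nonneg_nonneg mult_less_0_iff)
  have \<kappa>': "(\<Sum>n<N. real (\<kappa> n)) \<le> real k"
    using \<kappa> by (metis of_nat_le_iff of_nat_sum)
  have main: "c * (\<Sum>n<N. h (\<kappa> n)) \<le> 3 * \<delta> * N * s k" if "N \<le> k"
  proof -
    \<comment> \<open>This is the k/N of the introduction, rounded down.\<close>
    define q where "q = k div N"
    have q: "1 \<le> q" "q * N \<le> k" "k < N * (q + 1)"
      using N that by (auto simp: q_def div_greater_zero_iff Suc_le_eq dividend_less_times_div)
    \<comment> \<open>One bound for both regimes: monotonicity handles \<open>m \<le> q\<close> and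
      quasiconcavity handles \<open>m > q\<close>. It is affine in \<open>m\<close>, so summing over
      the blocks only involves the total size.\<close>
    have "c * q * h m \<le> (q + m) * s q" for m
    proof (cases "m = 0 \<or> m \<le> q")
      case True
      have "c * h m \<le> 1 * s q"
        using True s_mono[of m q] s_pos[of q] q(1) c_le_1 c_pos s_pos[of m]
        by (intro mult_mono) (auto simp: h_def)
      then have "q * (c * h m) \<le> q * s q"
        by (intro mult_left_mono) auto
      also have "\<dots> \<le> (q + m) * s q"
        using s_pos[of q] q(1) by (intro mult_right_mono) auto
      finally show ?thesis
        by (simp add: ac_simps)
    next
      case False
      then have "c * q * h m \<le> m * s q"
        using quasiconcave[of q m] q(1) by (simp add: h_def)
      also have "\<dots> \<le> (q + m) * s q"
        using s_pos[of q] q(1) by (intro mult_right_mono) auto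
      finally show ?thesis .
    qed
    then have "(\<Sum>n<N. c * q * h (\<kappa> n)) \<le> (\<Sum>n<N. (q + real (\<kappa> n)) * s q)"
      by (intro sum_mono) auto
    also have "\<dots> = (N * q + (\<Sum>n<N. real (\<kappa> n))) * s q"
      by (simp add: sum_distrib_right[symmetric] sum.distrib)
    also have "\<dots> \<le> (3 * N * q) * s q"
    proof (rule mult_right_mono)
      \<comment> \<open>The factor 3 arises here: \<open>k < N * (q + 1) \<le> 2 * N * q\<close>, to
        which the term \<open>N * q\<close> is added.\<close>
      have "real k \<le> real (N * (q + 1))"
        using q(3) by (simp only: of_nat_le_iff)
      also have "\<dots> \<le> real (N * (2 * q))"
        using q(1) by (simp only: of_nat_le_iff) simp
      finally show "N * q + (\<Sum>n<N. real (\<kappa> n)) \<le> 3 * N * q"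
        using \<kappa>' by simp
    qed (use s_pos[of q] q(1) in simp)
    also have "\<dots> \<le> (3 * N * q) * (\<delta> * s k)"
    proof (rule mult_left_mono)
      have "s q \<le> \<delta> * s (q * N)"
        by (rule \<delta>[OF q(1)])
      also have "\<dots> \<le> \<delta> * s k"
        using \<delta>_nonneg q N by (intro mult_left_mono s_mono) auto
      finally show "s q \<le> \<delta> * s k" .
    qed auto
    finally have "q * (c * (\<Sum>n<N. h (\<kappa> n))) \<le> q * (3 * \<delta> * N * s k)"
      by (simp add: sum_distrib_left ac_simps)
    then show ?thesis
      using q(1) by simp
  qed
  \<comment> \<open>Here \<open>k div N\<close> would be 0, so sizes are compared with
    \<open>s 1\<close> instead. The second factor \<open>c\<close> pays for passing from
    \<open>s N\<close> back to \<open>s k\<close> by quasiconcavity.\<close>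
  have small: "c\<^sup>2 * (\<Sum>n<N. h (\<kappa> n)) \<le> \<delta> * N * s k" if "k < N"
  proof -
    have "c * h m \<le> m * s 1" for m
      using quasiconcave[of 1 m] by (cases "m = 0") (auto simp: h_def)
    then have "(\<Sum>n<N. c * h (\<kappa> n)) \<le> (\<Sum>n<N. \<kappa> n * s 1)"
      by (intro sum_mono) auto
    also have "\<dots> = (\<Sum>n<N. real (\<kappa> n)) * s 1"
      by (simp add: sum_distrib_right)
    also have "\<dots> \<le> k * s 1"
      using \<kappa>' s_pos[of 1] by (intro mult_right_mono) auto
    also have "\<dots> \<le> k * (\<delta> * s N)"
      using \<delta>[of 1] by (intro mult_left_mono) auto
    finally have "c * (c * (\<Sum>n<N. h (\<kappa> n))) \<le> c * (k * (\<delta> * s N))"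
      using c_pos by (intro mult_left_mono) (auto simp: sum_distrib_left)
    also have "\<dots> = \<delta> * (c * k * s N)"
      by (simp add: ac_simps)
    also have "\<dots> \<le> \<delta> * (N * s k)"
      using \<delta>_nonneg quasiconcave[of k N] k that by (intro mult_left_mono) auto
    finally show ?thesis
      by (simp add: power2_eq_square ac_simps)
  qed
  have nonneg: "0 \<le> \<delta> * N * s k" "0 \<le> (\<Sum>n<N. h (\<kappa> n))"
    using \<delta>_nonneg s_pos[of k] k by (auto simp: h_def intro!: sum_nonneg less_imp_le[OF s_pos])
  have "c\<^sup>2 * (\<Sum>n<N. h (\<kappa> n)) \<le> 3 * \<delta> * N * s k"
  proof (cases "N \<le> k")
    case True
    have "c\<^sup>2 * (\<Sum>n<N. h (\<kappa> n)) \<le> c * (\<Sum>n<N. h (\<kappa> n))"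
      using c_pos c_le_1 nonneg(2) by (intro mult_right_mono) (auto simp: power2_eq_square mult_le_cancel_left1)
    then show ?thesis
      using main[OF True] by linarith
  next
    case False
    then show ?thesis
      using small nonneg(1) by linarith
  qed
  then show ?thesis
    by (simp add: h_def)
qed

section \<open>The infimum condition as a uniform estimate\<close>

lemma ratio_bounds:
  assumes "1 \<le> n" "1 \<le> k"
  shows "0 \<le> s k / s (k * n)" "s k / s (k * n) \<le> 1"
  using assms s_pos[of k] s_pos[of "k * n"] s_mono[of k "k * n"] by auto

text \<open>Real suprema have their usual properties only on bounded sets, so boundedness must be on
  record before \<open>SUP\<close> and \<open>INF\<close> are unfolded.\<close>

lemma bdd_above_ratio: "1 \<le> n \<Longrightarrow> bdd_above ((\<lambda>k. s k / s (k * n)) ` {1..})"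
  using ratio_bounds by (intro bdd_aboveI2[where M = 1]) auto

lemma SUP_ratio_nonneg: "1 \<le> n \<Longrightarrow> 0 \<le> (SUP k\<in>{1..}. s k / s (k * n))"
  using cSUP_upper[OF _ bdd_above_ratio, of 1 n] ratio_bounds(1)[of n 1] by simp

lemma INF_eq_0_iff:
  "(INF n\<in>{1..}. SUP k\<in>{1..}. s k / s (k * n)) = 0 \<longleftrightarrow>
   (\<forall>\<delta>>0. \<exists>N\<ge>1. \<forall>k\<ge>1. s k \<le> \<delta> * s (k * N))" (is "?I = 0 \<longleftrightarrow> ?R")
proof
  have bdd: "bdd_below ((\<lambda>n. SUP k\<in>{1..}. s k / s (k * n)) ` {1..})"
    using SUP_ratio_nonneg by (intro bdd_belowI2[where m = 0]) auto
  {
    assume I: "?I = 0"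
    show ?R
    proof (intro allI impI)
      fix \<delta> :: real assume "\<delta> > 0"
      then obtain N where N: "1 \<le> N" "(SUP k\<in>{1..}. s k / s (k * N)) < \<delta>"
        using I cINF_less_iff[OF _ bdd, of \<delta>] by auto
      have "s k \<le> \<delta> * s (k * N)" if "1 \<le> k" for k
        using cSUP_upper[OF _ bdd_above_ratio[OF N(1)], of k] N that s_pos[of "k * N"]
        by (simp add: divide_le_eq) (smt (verit) divide_le_eq mult_right_mono)
      then show "\<exists>N\<ge>1. \<forall>k\<ge>1. s k \<le> \<delta> * s (k * N)"
        using N(1) by blast
    qed
  }
  {
    assume R: ?R
    have "?I \<le> \<delta>" if "\<delta> > 0" for \<delta>
    proof -
      obtain N where N: "1 \<le> N" "\<And>k. 1 \<le> k \<Longrightarrow> s k \<le> \<delta> * s (k * N)"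
        using R \<open>\<delta> > 0\<close> by blast
      have "(SUP k\<in>{1..}. s k / s (k * N)) \<le> \<delta>"
        using N s_pos by (intro cSUP_least) (auto simp: divide_le_eq)
      then show ?thesis
        using cINF_lower[OF bdd, of N] N(1) by simp
    qed
    then have "?I \<le> 0"
      by (rule dense_ge)
    moreover have "0 \<le> ?I"
      using SUP_ratio_nonneg by (intro cINF_greatest) auto
    ultimately show "?I = 0"
      by simp
  }
qed

end

section \<open>Lechner's condition\<close>

text \<open>The increasing enumeration of \<open>A\<close> is split along the pairing bijection
  between pairs and naturals.\<close>

lemma infinite_disjoint_subsets:
  assumes "infinite (A :: nat set)"
  obtains B :: "nat \<Rightarrow> nat set"
  where "disjoint_family B" "\<And>n. infinite (B n)" "\<And>n. B n \<subseteq> A"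
proof
  define B where "B n = range (\<lambda>m. enumerate A (prod_encode (n, m)))" for n
  have inj: "enumerate A i = enumerate A j \<longleftrightarrow> i = j" for i j
    using inj_enumerate[OF assms] by (auto dest: injD)
  show "disjoint_family B"
    by (auto simp: disjoint_family_on_def B_def inj)
  show "infinite (B n)" for n
    unfolding B_def by (intro range_inj_infinite) (auto simp: inj_def inj)
  show "B n \<subseteq> A" for n
    using assms by (auto simp: B_def enumerate_in_set)
qed

locale marcinkiewicz_essentially_decreasing =
  marcinkiewicz_space s M + W: essentially_decreasing_derivative s w c
  for s w :: "nat \<Rightarrow> real" and c :: real
    and M :: "('f::{real_normed_field,banach}, nat \<Rightarrow> 'f) nspace"
begin

text \<open>A copy of \<open>w\<close> along \<open>B\<close> in increasing order, scaled by
  \<open>c\<close> so that its norm in m(s) is at most 1. \<open>Suc\<close> reconciles ranks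
  counted from 0 with weights indexed from 1.\<close>

definition spread :: "nat set \<Rightarrow> nat \<Rightarrow> 'f" where
  "spread B j = (if j \<in> B then of_real (c * w (Suc (inv (enumerate B) j))) else 0)"

lemma norm_spread:
  "norm (spread B j) = (if j \<in> B then c * w (Suc (inv (enumerate B) j)) else 0)"
  using W.c_pos W.w_pos[of "Suc (inv (enumerate B) j)"] by (simp add: spread_def norm_mult)

lemma sum_spread:
  assumes "infinite B"
  shows "(\<Sum>j\<in>enumerate B ` {..<k}. norm (spread B j)) = c * (\<Sum>i=1..k. w i)"
proof -
  have "(\<Sum>j\<in>enumerate B ` {..<k}. norm (spread B j)) = (\<Sum>i<k. c * w (Suc i))"
    using assms by (simp add: sum.reindex inj_on_subset[OF inj_enumerate]
        inj_enumerate enumerate_in_set norm_spread)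
  also have "\<dots> = c * (\<Sum>i=1..k. w i)"
    by (simp add: sum_distrib_left sum.atLeast1_atMost_eq)
  finally show ?thesis .
qed

text \<open>The ranks in \<open>B\<close> of the points of \<open>S \<inter> B\<close> form a set of
  equal size, to which \<open>sum_w_le\<close> applies. The factor 1 plays the part of
  \<open>C\<close> in the lemmas on \<open>functional\<close>.\<close>

lemma sum_spread_le:
  assumes "infinite B" "finite S" "S \<noteq> {}"
  shows "(\<Sum>j\<in>S. norm (spread B j)) \<le> 1 * s (card S)"
proof (cases "S \<inter> B = {}")
  case True
  then have "(\<Sum>j\<in>S. norm (spread B j)) = 0"
    by (auto simp: spread_def intro!: sum.neutral)
  then show ?thesis
    using s_card_pos[OF assms(2,3)] by simp
next
  case False
  define T where "T = (\<lambda>j. Suc (inv (enumerate B) j)) ` (S \<inter> B)"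
  have B: "B = range (enumerate B)"
    using assms(1) by (simp add: range_enumerate)
  then have inj: "inj_on (\<lambda>j. Suc (inv (enumerate B) j)) (S \<inter> B)"
    using inj_on_inv_into[of "S \<inter> B" "enumerate B" UNIV] by (auto simp: inj_on_def)
  have "(\<Sum>j\<in>S. norm (spread B j)) = (\<Sum>j\<in>S \<inter> B. c * w (Suc (inv (enumerate B) j)))"
    using assms(2) by (intro sum.mono_neutral_cong_right) (auto simp: norm_spread)
  also have "\<dots> = c * (\<Sum>i\<in>T. w i)"
    unfolding T_def by (simp add: sum.reindex[OF inj] sum_distrib_left)
  also have "\<dots> \<le> s (card T)"
    using False assms(2) by (intro W.sum_w_le) (auto simp: T_def)
  also have "\<dots> \<le> s (card S)"
    using False assms(2) card_mono[of S "S \<inter> B"]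
    by (intro W.s_mono) (auto simp: T_def card_image[OF inj] Suc_le_eq card_gt_0_iff)
  finally show ?thesis by simp
qed

text \<open>The lower l_1 estimate: on the first \<open>k\<close> points of each of \<open>N\<close>
  blocks the coordinates of \<open>g\<close> have total size equal to the left side, and
  \<open>dual_coordinates_sum_le\<close> bounds it.\<close>

lemma blocks_lower_bound:
  assumes B: "disjoint_family B" "\<And>n. infinite (B n)"
    and nsum: "has_nsum (dual D.Y)
      (\<lambda>n. smul (dual D.Y) (a n) (adjoint D.Y (adjoint E.Y (trunc (B n))) (functional (spread (B n))))) UNIV g"
    and N: "1 \<le> N" and k: "1 \<le> k"
  shows "(\<Sum>n<N. norm (a n)) * (c * s k) \<le> nrm (dual D.Y) g * s (k * N)"
proof -
  have fmem: "functional (spread (B n)) \<in> vecs (dual D.Y)" for n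
    by (rule functional_mem[OF sum_spread_le[OF B(2)]])
  have f_biorth: "functional (spread (B n)) (E.biorth j) = spread (B n) j" for n j
    by (rule functional_biorth[OF sum_spread_le[OF B(2)]])
  \<comment> \<open>Evaluation at coordinate \<open>j\<close> passes through the unordered sum, and
    by disjointness only the block containing \<open>j\<close> contributes.\<close>
  have g: "g (E.biorth j) = a m * spread (B m) j" if j: "j \<in> B m" for j m
  proof -
    let ?h = "\<lambda>n. smul (dual D.Y) (a n) (adjoint D.Y (adjoint E.Y (trunc (B n))) (functional (spread (B n))))"
    have h_mem: "?h n \<in> vecs (dual D.Y)" for n
      by (intro D.dual_Y.smul_mem D.adjoint_P_mem fmem)
    have j_iff: "j \<in> B n \<longleftrightarrow> n = m" for n
      using B(1) j by (auto simp: disjoint_family_on_def)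
    have eval_h: "D.eval j (?h n) = a n * (if j \<in> B n then spread (B n) j else 0)" for n
      unfolding D.eval_def if_P[OF h_mem]
      by (simp only: D.Y.smul_dual block_apply_biorth[OF fmem] f_biorth)
    have "D.eval j (?h n) = (if n = m then a m * spread (B m) j else 0)" for n
      unfolding eval_h j_iff by simp
    moreover have "((\<lambda>F. \<Sum>n\<in>F. D.eval j (?h n)) \<longlongrightarrow> D.eval j g) (finite_subsets_at_top UNIV)"
      by (rule D.dual_Y.dual_tendsto[OF D.eval_mem h_mem nsum])
    ultimately have 1: "((\<lambda>F. \<Sum>n\<in>F. if n = m then a m * spread (B m) j else 0) \<longlongrightarrow> D.eval j g)
        (finite_subsets_at_top UNIV)"
      by simp
    have 2: "((\<lambda>F. \<Sum>n\<in>F. if n = m then a m * spread (B m) j else 0) \<longlongrightarrow> a m * spread (B m) j)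
        (finite_subsets_at_top UNIV)"
      by (rule tendsto_eventually, unfold eventually_finite_subsets_at_top,
          rule exI[of _ "{m}"]) auto
    have "D.eval j g = a m * spread (B m) j"
      by (rule tendsto_unique[OF _ 1 2]) simp
    then show ?thesis
      using nsum by (simp add: D.eval_def has_nsum_def)
  qed
  define U where "U n = enumerate (B n) ` {..<k}" for n
  have U: "finite (U n)" "card (U n) = k" "U n \<subseteq> B n" for n
    using B(2) by (auto simp: U_def card_image inj_on_subset[OF inj_enumerate] enumerate_in_set)
  have disj: "U m \<inter> U n = {}" if "m \<noteq> n" for m n
    using disjoint_family_onD[OF B(1) _ _ that] U(3)[of m] U(3)[of n] by auto
  have card: "card (\<Union>n<N. U n) = k * N"
    using card_UN_disjoint[of "{..<N}" U] disj U by (simp add: mult.commute)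
  have "(\<Sum>j\<in>(\<Union>n<N. U n). norm (g (E.biorth j))) = (\<Sum>n<N. \<Sum>j\<in>U n. norm (g (E.biorth j)))"
    using disj U by (intro sum.UNION_disjoint) auto
  also have "\<dots> = (\<Sum>n<N. \<Sum>j\<in>U n. norm (a n) * norm (spread (B n) j))"
    using g[OF subsetD[OF U(3)]] by (intro sum.cong refl) (simp add: norm_mult)
  also have "\<dots> = (\<Sum>n<N. norm (a n) * (c * s k))"
    unfolding sum_distrib_left[symmetric] U_def sum_spread[OF B(2)] using k by (simp add: W.s_eq)
  finally have "(\<Sum>n<N. norm (a n)) * (c * s k) = (\<Sum>j\<in>(\<Union>n<N. U n). norm (g (E.biorth j)))"
    by (simp add: sum_distrib_right)
  also have "\<dots> \<le> nrm (dual D.Y) g * s (card (\<Union>n<N. U n))"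
  proof (rule dual_coordinates_sum_le)
    show "(\<Union>n<N. U n) \<noteq> {}"
      using card N k by force
  qed (use nsum U in \<open>auto simp: has_nsum_def\<close>)
  finally show ?thesis
    by (simp add: card)
qed

text \<open>If the estimate failed for \<delta>, every \<open>N\<close> would have its own
  \<open>k\<close> violating it. Lechner's condition on the set of all naturals then yields
  coefficients whose partial sums stay below 1/2, although they sum to 1.\<close>

lemma lechner_imp:
  assumes "lechner M unit_vector" "\<delta> > 0"
  shows "\<exists>N\<ge>1. \<forall>k\<ge>1. s k \<le> \<delta> * s (k * N)"
proof (rule ccontr)
  assume contra: "\<not> ?thesis"
  \<comment> \<open>Half the lower l_1 constant \<open>c * \<delta>\<close>, so that the partial
    sums come out at most 1/2.\<close>
  define \<theta> where "\<theta> = c * \<delta> / 2"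
  have "\<theta> > 0"
    using W.c_pos \<open>\<delta> > 0\<close> by (simp add: \<theta>_def)
  then obtain B :: "nat \<Rightarrow> nat set" where B: "disjoint_family B" "\<And>n. infinite (B n)"
    and L: "\<And>\<phi>. (\<And>n. \<phi> n \<in> vecs (dual D.Y) \<and> nrm (dual D.Y) (\<phi> n) \<le> 1) \<Longrightarrow>
         small_combination B \<phi> \<theta>"
    using assms(1) infinite_UNIV_nat unfolding lechner_iff by metis
  obtain a g where ag: "(\<lambda>n. norm (a n)) sums 1"
    "has_nsum (dual D.Y)
      (\<lambda>n. smul (dual D.Y) (a n) (adjoint D.Y (adjoint E.Y (trunc (B n))) (functional (spread (B n))))) UNIV g"
    "nrm (dual D.Y) g \<le> \<theta>"
    using L[of "\<lambda>n. functional (spread (B n))"] functional_mem[OF sum_spread_le[OF B(2)]]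
      nrm_functional_le[OF sum_spread_le[OF B(2)]]
    unfolding small_combination_def by blast
  have "(\<Sum>n<N. norm (a n)) \<le> 1 / 2" if N: "1 \<le> N" for N
  proof -
    obtain k where k: "1 \<le> k" "\<delta> * s (k * N) < s k"
      using contra N by (meson not_le)
    let ?S = "\<Sum>n<N. norm (a n)"
    have pos: "0 < s (k * N)"
      using k N by (intro s_pos) simp
    have "?S * (c * (\<delta> * s (k * N))) \<le> ?S * (c * s k)"
      using k W.c_pos by (intro mult_left_mono) (auto intro: sum_nonneg)
    also have "\<dots> \<le> nrm (dual D.Y) g * s (k * N)"
      by (rule blocks_lower_bound[OF B ag(2) N k(1)])
    also have "\<dots> \<le> \<theta> * s (k * N)"
      using ag(3) pos by (intro mult_right_mono) auto
    finally have "?S * (c * \<delta> * s (k * N)) \<le> 1 / 2 * (c * \<delta> * s (k * N))"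
      by (simp add: \<theta>_def mult.assoc)
    then show ?thesis
      by (rule mult_right_le_imp_le) (use W.c_pos \<open>\<delta> > 0\<close> pos in simp)
  qed
  then have "(1 :: real) \<le> 1 / 2"
    using ag(1) unfolding sums_def by (intro LIMSEQ_le_const2) auto
  then show False
    by simp
qed

text \<open>By \<open>dual_coordinates_sum_le\<close>, block \<open>n\<close> puts mass at most
  \<open>s (card (S \<inter> B n))\<close> on \<open>S\<close>. Disjointness makes these sizes add
  up to at most \<open>card S\<close>, which is the situation of
  \<open>sum_split_le\<close>.\<close>

lemma average_blocks_le:
  assumes B: "disjoint_family B"
    and \<phi>: "\<And>n. \<phi> n \<in> vecs (dual D.Y)" "\<And>n. nrm (dual D.Y) (\<phi> n) \<le> 1"
    and N: "1 \<le> N" and \<delta>: "\<And>k. 1 \<le> k \<Longrightarrow> s k \<le> \<delta> * s (k * N)"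
    and g: "g = (\<Sum>n<N. smul (dual D.Y) (of_real (1 / N)) (adjoint D.Y (adjoint E.Y (trunc (B n))) (\<phi> n)))"
  shows "nrm (dual D.Y) g \<le> 3 * \<delta> / c\<^sup>2"
proof (rule nrm_dual_le_coordinates)
  show "g \<in> vecs (dual D.Y)"
    unfolding g by (intro D.dual_Y.sum_mem D.dual_Y.smul_mem D.adjoint_P_mem \<phi>)
  fix S :: "nat set" assume S: "finite S" "S \<noteq> {}"
  have g_apply: "g (E.biorth j) = (\<Sum>n<N. if j \<in> B n then of_real (1 / N) * \<phi> n (E.biorth j) else 0)" for j
  proof -
    have "(\<Sum>n\<in>I. smul (dual D.Y) (of_real (1 / N)) (adjoint D.Y (adjoint E.Y (trunc (B n))) (\<phi> n))) (E.biorth j) =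
      (\<Sum>n\<in>I. if j \<in> B n then of_real (1 / N) * \<phi> n (E.biorth j) else 0)" if "finite I" for I
      using that by (induction I) (auto simp: D.Y.smul_dual block_apply_biorth[OF \<phi>(1)])
    then show ?thesis
      by (simp add: g)
  qed
  have "(\<Sum>j\<in>S. norm (g (E.biorth j))) \<le>
      (\<Sum>j\<in>S. \<Sum>n<N. if j \<in> B n then 1 / N * norm (\<phi> n (E.biorth j)) else 0)"
    unfolding g_apply by (intro sum_mono sum_norm_le) (auto simp: norm_mult norm_divide)
  also have "\<dots> = (\<Sum>n<N. \<Sum>j\<in>S. if j \<in> B n then 1 / N * norm (\<phi> n (E.biorth j)) else 0)"
    by (rule sum.swap)
  also have "\<dots> = (\<Sum>n<N. 1 / N * (\<Sum>j\<in>S \<inter> B n. norm (\<phi> n (E.biorth j))))"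
    using S(1) by (simp add: sum.inter_restrict[symmetric] sum_distrib_left)
  \<comment> \<open>Blocks missing \<open>S\<close> contribute 0 and must not be charged with
    \<open>s 0\<close>.\<close>
  also have "\<dots> \<le> (\<Sum>n<N. 1 / N * (if card (S \<inter> B n) = 0 then 0 else s (card (S \<inter> B n))))"
  proof (intro sum_mono mult_left_mono)
    fix n
    show "(\<Sum>j\<in>S \<inter> B n. norm (\<phi> n (E.biorth j))) \<le> (if card (S \<inter> B n) = 0 then 0 else s (card (S \<inter> B n)))"
    proof (cases "S \<inter> B n = {}")
      case False
      then have "(\<Sum>j\<in>S \<inter> B n. norm (\<phi> n (E.biorth j))) \<le> nrm (dual D.Y) (\<phi> n) * s (card (S \<inter> B n))"
        using S by (intro dual_coordinates_sum_le \<phi>) auto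
      also have "\<dots> \<le> 1 * s (card (S \<inter> B n))"
        using False S s_card_pos[of "S \<inter> B n"] by (intro mult_right_mono \<phi>) auto
      finally show ?thesis
        using False S by simp
    qed simp
  qed simp
  also have "\<dots> = (\<Sum>n<N. if card (S \<inter> B n) = 0 then 0 else s (card (S \<inter> B n))) / N"
    by (simp add: sum_divide_distrib)
  also have "\<dots> \<le> 3 * \<delta> / c\<^sup>2 * s (card S)"
  proof -
    have "(\<Sum>n<N. card (S \<inter> B n)) = card (\<Union>n<N. S \<inter> B n)"
      using B S by (intro card_UN_disjoint[symmetric]) (auto simp: disjoint_family_on_def)
    also have "\<dots> \<le> card S"
      using S by (intro card_mono) auto
    finally have "c\<^sup>2 * (\<Sum>n<N. if card (S \<inter> B n) = 0 then 0 else s (card (S \<inter> B n))) \<le> 3 * \<delta> * N * s (card S)"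
      using S by (intro W.sum_split_le N \<delta>) (auto simp: Suc_le_eq card_gt_0_iff)
    then show ?thesis
      using N W.c_pos by (simp add: field_simps)
  qed
  finally show "(\<Sum>j\<in>S. norm (g (E.biorth j))) \<le> 3 * \<delta> / c\<^sup>2 * s (card S)" .
qed

text \<open>Any disjoint infinite subsets of \<open>A\<close> will do, and the same coefficients,
  equal to \<open>1 / N\<close> on the first \<open>N\<close> blocks, serve every choice of
  functionals.\<close>

lemma lechner_if:
  assumes "\<And>\<delta>. 0 < \<delta> \<Longrightarrow> \<exists>N\<ge>1. \<forall>k\<ge>1. s k \<le> \<delta> * s (k * N)"
  shows "lechner M unit_vector"
  unfolding lechner_iff
proof (intro allI impI)
  fix A :: "nat set" and \<theta> :: real assume A: "infinite A" and \<theta>: "\<theta> > 0"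
  obtain B :: "nat \<Rightarrow> nat set" where B: "disjoint_family B" "\<And>n. infinite (B n)" "\<And>n. B n \<subseteq> A"
    using infinite_disjoint_subsets[OF A] by blast
  \<comment> \<open>Chosen so that the bound \<open>3 * \<delta> / c\<^sup>2\<close> of
    \<open>average_blocks_le\<close> equals \<theta>.\<close>
  define \<delta> where "\<delta> = \<theta> * c\<^sup>2 / 3"
  have "\<delta> > 0"
    using \<theta> W.c_pos by (simp add: \<delta>_def)
  then obtain N where N: "1 \<le> N" "\<And>k. 1 \<le> k \<Longrightarrow> s k \<le> \<delta> * s (k * N)"
    using assms by blast
  have "small_combination B \<phi> \<theta>"
    if \<phi>: "\<forall>n. \<phi> n \<in> vecs (dual D.Y) \<and> nrm (dual D.Y) (\<phi> n) \<le> 1" for \<phi>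
  proof -
    define a :: "nat \<Rightarrow> 'f" where "a n = (if n < N then of_real (1 / N) else 0)" for n
    define h where "h n = smul (dual D.Y) (a n) (adjoint D.Y (adjoint E.Y (trunc (B n))) (\<phi> n))" for n
    have "(\<lambda>n. norm (a n)) sums (\<Sum>n<N. norm (a n))"
      by (intro sums_finite) (auto simp: a_def)
    also have "(\<Sum>n<N. norm (a n)) = 1"
      using N(1) by (simp add: a_def norm_divide)
    finally have sums: "(\<lambda>n. norm (a n)) sums 1" .
    have h_mem: "h n \<in> vecs (dual D.Y)" for n
      unfolding h_def using \<phi> by (intro D.dual_Y.smul_mem D.adjoint_P_mem) auto
    have nsum: "has_nsum (dual D.Y) h UNIV (sum h {..<N})"
      by (rule D.dual_Y.has_nsum_finite) (auto simp: h_mem, simp add: h_def a_def)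
    have "nrm (dual D.Y) (sum h {..<N}) \<le> 3 * \<delta> / c\<^sup>2"
      by (rule average_blocks_le[OF B(1) _ _ N, of \<phi>]) (use \<phi> in \<open>auto simp: h_def a_def\<close>)
    also have "\<dots> = \<theta>"
      using W.c_pos by (simp add: \<delta>_def)
    finally show ?thesis
      using sums nsum unfolding h_def small_combination_def by blast
  qed
  then show "\<exists>B :: nat \<Rightarrow> nat set. disjoint_family B \<and> (\<forall>n. infinite (B n) \<and> B n \<subseteq> A) \<and>
       (\<forall>\<phi>. (\<forall>n. \<phi> n \<in> vecs (dual D.Y) \<and> nrm (dual D.Y) (\<phi> n) \<le> 1) \<longrightarrow>
         small_combination B \<phi> \<theta>)"
    using B by blast
qed

lemma lechner_iff_INF:
  "lechner M unit_vector \<longleftrightarrow> (INF n\<in>{1..}. SUP k\<in>{1..}. s k / s (k * n)) = 0"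
  unfolding W.INF_eq_0_iff using lechner_imp lechner_if by blast

end

theorem theorem3p4:
  fixes s w :: "nat \<Rightarrow> real"
  assumes "weight s"
    and "mono_on {1..} s"
    and "discrete_derivative s w"
    and "essentially_decreasing w"
  shows "(lechner (marcinkiewicz s :: (real, nat \<Rightarrow> real) nspace) unit_vector \<longleftrightarrow>
            (INF n\<in>{1..}. SUP k\<in>{1..}. s k / s (k * n)) = 0) \<and>
         (lechner (marcinkiewicz s :: (complex, nat \<Rightarrow> complex) nspace) unit_vector \<longleftrightarrow>
            (INF n\<in>{1..}. SUP k\<in>{1..}. s k / s (k * n)) = 0)"
proof -
  define c where "c = Inf {w m / w n | m n. 1 \<le> m \<and> m \<le> n}"
  have w_pos: "0 < w n" if "1 \<le> n" for n
    using assms(3) that by (simp add: discrete_derivative_def weight_def)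
  \<comment> \<open>Needed for the infimum \<open>c\<close> to be a genuine lower bound of the
    quotients.\<close>
  have bdd: "bdd_below {w m / w n | m n. 1 \<le> m \<and> m \<le> n}"
    using w_pos by (intro bdd_belowI[where m = 0]) (auto intro!: divide_nonneg_nonneg less_imp_le)
  have W: "essentially_decreasing_derivative s w c"
  proof
    show "0 < c"
      using assms(4) by (simp add: c_def essentially_decreasing_def)
    show "c * w n \<le> w m" if "1 \<le> m" "m \<le> n" for m n
    proof -
      have "c \<le> w m / w n"
        unfolding c_def using that by (intro cInf_lower[OF _ bdd]) auto
      then show ?thesis
        using w_pos[of n] that by (simp add: field_simps)
    qed
  qed (use assms(3) w_pos in \<open>auto simp: discrete_derivative_def\<close>)
  interpret R: marcinkiewicz_essentially_decreasing s w c "marcinkiewicz s :: (real, nat \<Rightarrow> real) nspace"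
    by (intro marcinkiewicz_essentially_decreasing.intro marcinkiewicz_space.intro W assms(1,2) refl)
  interpret C: marcinkiewicz_essentially_decreasing s w c "marcinkiewicz s :: (complex, nat \<Rightarrow> complex) nspace"
    by (intro marcinkiewicz_essentially_decreasing.intro marcinkiewicz_space.intro W assms(1,2) refl)
  show ?thesis
    using R.lechner_iff_INF C.lechner_iff_INF by blast
qed

end
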